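(* Suppose the operator regularity assumption (stated in the context) holds. For $i=1,\ldots,N-1$ let $$C^{b}_{\delta_i}:=8C_{\nabla^2 f}^2C_v^2\sum_{j=i}^{N-1}\Big[\sum_{k=0}^{j}(3C_{\nabla f}^2)^{k}\Big](4C_{\nabla f}^2)^{j-i},\qquad C^{b}_{\varepsilon_{i+1}}:=2\sum_{j=1}^{i}(3C_{\nabla f}^2)^{j},\qquad \tilde C^{b}_{\delta_i}:=8\sum_{j=i}^{N-1}C_{y_j}^2(8L_f^4)^{j-i},$$ where $$C_{y_i}^2:=8C_{\nabla^2 f}^2L_{\nabla f}^2C_v^2\sum_{j=i+1}^{N-1}\Big[\sum_{k=0}^{j}(3C_{\nabla f}^2)^{k}\Big](4C_{\nabla f}^2)^{j-i-1}+2L_{\nabla^2 f}^2C_v^2\sum_{j=0}^{i}(3C_{\nabla f}^2)^{j}.$$ Then for all $t=1,2,\ldots,T$, $$\mathbb{E}\Big[\big\|\mathbb{E}_t[\tilde{\boldsymbol{u}}^{(t)}-\boldsymbol{u}^{(t)}]\big\|^2\Big]\le\sum_{i=1}^{N-1}C^{b}_{\delta_i}\mathbb{E}\Big[\big\|\mathbb{E}_t^{\mathcal{G}_i}[\delta_i^{(t)}]\big\|^2\Big]+\sum_{i=1}^{N-1}\tilde C^{b}_{\delta_i}\mathbb{E}\Big[\big\|\delta_i^{(t)}\big\|^4\Big]+\sum_{i=1}^{N-1}C^{b}_{\varepsilon_{i+1}}\mathbb{E}\Big[\big\|\mathbb{E}_t^{\mathcal{H}_{i+1}}[\varepsilon_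{i+1}^{(t)}]\big\|^2\Big].$$
   Context: Setting. Let $N\ge 2$, let $d_0,\ldots,d_{N-1},d_{w_1},\ldots,d_{w_N}$ be positive integers and $d_N=1$. For $i=1,\ldots,N$ let $f_i:\mathbb{R}^{d_{i-1}}\times\mathbb{R}^{d_{w_i}}\to\mathbb{R}^{d_i}$ be twice differentiable operators, and let $\mathcal{R}:\mathbb{R}^d\to\mathbb{R}$ be differentiable, where $\boldsymbol{w}=(w_1^\top,\ldots,w_N^\top)^\top\in\mathbb{R}^d$, $d=\sum_i d_{w_i}$. $\nabla_1 f_i\in\mathbb{R}^{d_i\times d_{i-1}}$ and $\nabla_2 f_i\in\mathbb{R}^{d_i\times d_{w_i}}$ denote the Jacobians of $f_i$ with respect to $y_{i-1}$ and $w_i$, and $\nabla^2_{21}f_i\in\mathbb{R}^{d_i\times d_{w_i}\times d_{i-1}}$ is the derivative of $\nabla_2 f_i$ with respect to $y_{i-1}$. Norms. $\|\cdot\|$ is the Euclidean norm for vectors and the Frobenius norm for matrices and tensors; $\|\cdot\|_{\mathrm{op}}$ is the induced operator norm. For $\mathcal{H}\in\mathbb{R}^{p\times m\times n}$ and $A\in\mathbb{R}^{m\times n}$, $[\mathcal{H}(A)]_j=\sum_{\alpha,\beta}\mathcal{H}_{j\alpha\beta}A_{\alpha\beta}$ and $\|\mathcal{H}\|_{\mathrm{op}}=\sup_{\|A\|=1}\|\mathcal{H}(A)\|$. Perturbed SGD. At iteration $t$, with current weights $\boldsymbol{w}^{(t)}$, data sample $x^{(t)}\in\mathbb{R}^{d_0}$,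 and random perturbations $\delta_i^{(t)}$ (forward) and $\varepsilon_i^{(t)}$ (backward): $\tilde y_0^{(t)}=x^{(t)}$, $\tilde y_i^{(t)}=f_i(\tilde y_{i-1}^{(t)},w_i^{(t)})+\delta_i^{(t)}$ for $i=1,\ldots,N$; $\tilde v_N^{(t)}=1$, $\tilde v_{i-1}^{(t)}=\nabla_1 f_i(\tilde y_{i-1}^{(t)},w_i^{(t)})^\top\tilde v_i^{(t)}+\varepsilon_i^{(t)}$ for $i=N,\ldots,2$; $\tilde u_i^{(t)}=\nabla_2 f_i(\tilde y_{i-1}^{(t)},w_i^{(t)})^\top\tilde v_i^{(t)}$ for $i=N,\ldots,1$; and $w_i^{(t+1)}=w_i^{(t)}-\gamma(\tilde u_i^{(t)}+r_i^{(t)})$ with step size $\gamma>0$ and $r_i^{(t)}=\nabla_{w_i}\mathcal{R}(\boldsymbol{w}^{(t)})$. The unperturbed quantities at the same $\boldsymbol{w}^{(t)}$ and $x^{(t)}$ are $y_0^{(t)}=x^{(t)}$, $y_i^{(t)}=f_i(y_{i-1}^{(t)},w_i^{(t)})$, $v_N^{(t)}=1$, $v_{i-1}^{(t)}=\nabla_1 f_i(y_{i-1}^{(t)},w_i^{(t)})^\top v_i^{(t)}$, $u_i^{(t)}=\nabla_2 f_i(y_{i-1}^{(t)},w_i^{(t)})^\top v_i^{(t)}$. Boldface denotes stacking: $\boldsymbol{u}^{(t)}=(u_1^{(t)\top},\ldots,u_N^{(t)\top})^\top$, $\tilde{\boldsymbol{u}}^{(t)}$ likewise. Filtrations. $\mathcal{F}^{(t)}$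 is the filtration generated up to iteration $t$, with conditional expectation $\mathbb{E}_t[\cdot]$; $\mathcal{G}_i^{(t)}=\sigma(\mathcal{F}^{(t)}\cup\{\tilde y_1^{(t)},\ldots,\tilde y_i^{(t)}\})$; $\mathcal{H}_i^{(t)}=\sigma(\mathcal{G}_N^{(t)}\cup\{\tilde v_N^{(t)},\ldots,\tilde v_i^{(t)}\})$; $\mathbb{E}_t^{\mathcal{G}_i}[\cdot]$ and $\mathbb{E}_t^{\mathcal{H}_i}[\cdot]$ are the conditional expectations with respect to $\mathcal{G}_i^{(t)}$ and $\mathcal{H}_i^{(t)}$. Operator regularity assumption. There exist constants $C_{\nabla f},C_{\nabla^2 f},L_f,L_{\nabla f},L_{\nabla^2 f}>0$ such that for each $i$ and all $y_{i-1},w_i$: (1) $\|\nabla_j f_i(y_{i-1},w_i)\|_{\mathrm{op}}\le C_{\nabla f}$ for $j=1,2$ and $\|\nabla^2_{21}f_i(y_{i-1},w_i)\|_{\mathrm{op}}\le C_{\nabla^2 f}$; (2) $f_i$ is $L_f$-Lipschitz in $y_{i-1}$ (Euclidean norm); (3) $\nabla f_i$ and $\nabla^2 f_i$ are Lipschitz with respect to both $y_{i-1}$ and $w_i$ with constants $L_{\nabla f}$ and $L_{\nabla^2 f}$ respectively (Frobenius norm). Constant. $C_v:=\max\{1,C_{\nabla f}^N\}$ (it satisfies $\|v_i^{(t)}\|\le C_v$). Empty sums are $0$.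
   Formalization: The bound fails if C_{∇²f} controls only ∇²_{21}f_i (e.g. N=2, f_1=x+w, f_2=sin y+w, small C_{∇²f}); the formal theorem additionally assumes ‖∇²_{11}f_i‖_op ≤ C_{∇²f} for i=2,…,N. *)

theory Defs
  imports "HOL-Probability.Probability"
begin

text \<open>
  The dimensions vary from layer to layer, so a vector of \<open>\<real>\<^sup>K\<close> (for a finite index set \<open>K\<close>) is a
  real function that vanishes outside \<open>K\<close>. We use \<open>K = {..<n}\<close> for \<open>\<real>\<^sup>n\<close>,
  \<open>K = {..<n} <+> {..<m}\<close> for pairs in \<open>\<real>\<^sup>n \<times> \<real>\<^sup>m\<close>, and a set of pairs
  (layer, component) for the stacked weights. The Euclidean norm on \<open>\<real>\<^sup>K\<close> is
  \<^term>\<open>\<lambda>x. L2_set x K\<close>; with a product as index set it is the Frobenius norm.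
\<close>

definition vecs :: "'k set \<Rightarrow> ('k \<Rightarrow> real) set" where
  "vecs K = {x. \<forall>k. k \<notin> K \<longrightarrow> x k = 0}"

text \<open>Frechet differentiability at \<open>x\<close> of a real function on \<open>\<real>\<^sup>K\<close>.\<close>

definition frechet_diff_at :: "'k set \<Rightarrow> (('k \<Rightarrow> real) \<Rightarrow> real) \<Rightarrow> ('k \<Rightarrow> real) \<Rightarrow> bool" where
  "frechet_diff_at K g x \<longleftrightarrow>
     (\<exists>a. \<forall>e>0. \<exists>r>0. \<forall>x'\<in>vecs K. L2_set (\<lambda>k. x' k - x k) K < r \<longrightarrow>
        \<bar>g x' - g x - (\<Sum>k\<in>K. a k * (x' k - x k))\<bar> \<le> e * L2_set (\<lambda>k. x' k - x k) K)"

definition partial :: "(('k \<Rightarrow> real) \<Rightarrow> real) \<Rightarrow> 'k \<Rightarrow> ('k \<Rightarrow> real) \<Rightarrow> real" where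
  "partial g k x = deriv (\<lambda>s. g (x(k := s))) (x k)"

text \<open>
  Induced operator norm of a matrix with row index set \<open>I\<close> and column index set \<open>K\<close>. A tensor
  in \<open>\<real>\<^sup>p\<^sup>\<times>\<^sup>m\<^sup>\<times>\<^sup>n\<close>, acting on \<open>m \<times> n\<close> matrices with the Frobenius norm, is the case
  \<open>K = {..<m} \<times> {..<n}\<close>.
\<close>

definition op_norm :: "'i set \<Rightarrow> 'k set \<Rightarrow> ('i \<Rightarrow> 'k \<Rightarrow> real) \<Rightarrow> real" where
  "op_norm I K A =
     (SUP x \<in> {x \<in> vecs K. L2_set x K = 1}. L2_set (\<lambda>i. \<Sum>k\<in>K. A i k * x k) I)"

type_synonym rvec = "nat \<Rightarrow> real"

type_synonym layer_map = "rvec \<Rightarrow> rvec \<Rightarrow> rvec"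

text \<open>
  \<open>jac f z j a\<close> and \<open>hess f z j a b\<close> are the first and second partial derivatives of the \<open>j\<close>-th
  component of \<open>f\<close> at the point \<open>z = case_sum y w\<close>, i.e. \<open>(y, w)\<close>; index \<open>Inl k\<close> means
  differentiation in \<open>y\<^sub>k\<close>, index \<open>Inr k\<close> in \<open>w\<^sub>k\<close>. In \<open>hess\<close> the index \<open>a\<close> is
  differentiated first.
\<close>

definition comp_fun :: "layer_map \<Rightarrow> nat \<Rightarrow> (nat + nat \<Rightarrow> real) \<Rightarrow> real" where
  "comp_fun f j z = f (z \<circ> Inl) (z \<circ> Inr) j"

definition jac :: "layer_map \<Rightarrow> (nat + nat \<Rightarrow> real) \<Rightarrow> nat \<Rightarrow> nat + nat \<Rightarrow> real" where
  "jac f z j a = partial (comp_fun f j) a z"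

definition hess :: "layer_map \<Rightarrow> (nat + nat \<Rightarrow> real) \<Rightarrow> nat \<Rightarrow> nat + nat \<Rightarrow> nat + nat \<Rightarrow> real" where
  "hess f z j a b = partial (\<lambda>z'. jac f z' j a) b z"

definition jac1 :: "layer_map \<Rightarrow> rvec \<Rightarrow> rvec \<Rightarrow> nat \<Rightarrow> nat \<Rightarrow> real" where
  "jac1 f y w j k = jac f (case_sum y w) j (Inl k)"

definition jac2 :: "layer_map \<Rightarrow> rvec \<Rightarrow> rvec \<Rightarrow> nat \<Rightarrow> nat \<Rightarrow> real" where
  "jac2 f y w j k = jac f (case_sum y w) j (Inr k)"

definition hess11 :: "layer_map \<Rightarrow> rvec \<Rightarrow> rvec \<Rightarrow> nat \<Rightarrow> nat \<times> nat \<Rightarrow> real" where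
  "hess11 f y w j = (\<lambda>(\<alpha>, \<beta>). hess f (case_sum y w) j (Inl \<alpha>) (Inl \<beta>))"

definition hess21 :: "layer_map \<Rightarrow> rvec \<Rightarrow> rvec \<Rightarrow> nat \<Rightarrow> nat \<times> nat \<Rightarrow> real" where
  "hess21 f y w j = (\<lambda>(\<alpha>, \<beta>). hess f (case_sum y w) j (Inr \<alpha>) (Inl \<beta>))"

text \<open>\<open>f\<close> is a twice differentiable operator from \<open>\<real>\<^sup>n \<times> \<real>\<^sup>m\<close> to \<open>\<real>\<^sup>p\<close>.\<close>

definition twice_diff_operator :: "nat \<Rightarrow> nat \<Rightarrow> nat \<Rightarrow> layer_map \<Rightarrow> bool" where
  "twice_diff_operator n m p f \<longleftrightarrow>
     (\<forall>y\<in>vecs {..<n}. \<forall>w\<in>vecs {..<m}. f y w \<in> vecs {..<p}) \<and>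
     (\<forall>z\<in>vecs ({..<n} <+> {..<m}). \<forall>j<p.
        frechet_diff_at ({..<n} <+> {..<m}) (comp_fun f j) z \<and>
        (\<forall>a\<in>{..<n} <+> {..<m}. frechet_diff_at ({..<n} <+> {..<m}) (\<lambda>z'. jac f z' j a) z))"

definition frob_jac_diff ::
  "nat \<Rightarrow> nat \<Rightarrow> nat \<Rightarrow> layer_map \<Rightarrow> rvec \<Rightarrow> rvec \<Rightarrow> rvec \<Rightarrow> rvec \<Rightarrow> real" where
  "frob_jac_diff n m p f y w y' w' =
     L2_set (\<lambda>(j, a). jac f (case_sum y w) j a - jac f (case_sum y' w') j a)
       ({..<p} \<times> ({..<n} <+> {..<m}))"

definition frob_hess_diff ::
  "nat \<Rightarrow> nat \<Rightarrow> nat \<Rightarrow> layer_map \<Rightarrow> rvec \<Rightarrow> rvec \<Rightarrow> rvec \<Rightarrow> rvec \<Rightarrow> real" where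
  "frob_hess_diff n m p f y w y' w' =
     L2_set (\<lambda>(j, a, b). hess f (case_sum y w) j a b - hess f (case_sum y' w') j a b)
       ({..<p} \<times> ({..<n} <+> {..<m}) \<times> ({..<n} <+> {..<m}))"

text \<open>
  The regularity assumption on one operator (of the second derivatives, its first part bounds
  \<^const>\<open>hess21\<close> only; a bound on \<^const>\<open>hess11\<close> is not part of it), with constants \<open>C1, C2, Lf, L1, L2\<close> standing for
  \<open>C\<^bsub>\<nabla>f\<^esub>\<close>, the second-derivative bound, \<open>L\<^sub>f\<close>, and the Lipschitz constants of \<open>\<nabla>f\<close> and of
  the second derivative. Lipschitz continuity ``with respect to both arguments'' is required in
  each argument separately; this follows from joint Lipschitz continuity with the same constant.
\<close>

definition regular_operator ::
  "nat \<Rightarrow> nat \<Rightarrow> nat \<Rightarrow> layer_map \<Rightarrow> real \<Rightarrow> real \<Rightarrow> real \<Rightarrow> real \<Rightarrow> real \<Rightarrow> bool" where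
  "regular_operator n m p f C1 C2 Lf L1 L2 \<longleftrightarrow>
     (\<forall>y\<in>vecs {..<n}. \<forall>w\<in>vecs {..<m}.
        op_norm {..<p} {..<n} (jac1 f y w) \<le> C1 \<and>
        op_norm {..<p} {..<m} (jac2 f y w) \<le> C1 \<and>
        op_norm {..<p} ({..<m} \<times> {..<n}) (hess21 f y w) \<le> C2) \<and>
     (\<forall>y\<in>vecs {..<n}. \<forall>y'\<in>vecs {..<n}. \<forall>w\<in>vecs {..<m}.
        L2_set (\<lambda>j. f y w j - f y' w j) {..<p} \<le> Lf * L2_set (\<lambda>k. y k - y' k) {..<n} \<and>
        frob_jac_diff n m p f y w y' w \<le> L1 * L2_set (\<lambda>k. y k - y' k) {..<n} \<and>
        frob_hess_diff n m p f y w y' w \<le> L2 * L2_set (\<lambda>k. y k - y' k) {..<n}) \<and>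
     (\<forall>y\<in>vecs {..<n}. \<forall>w\<in>vecs {..<m}. \<forall>w'\<in>vecs {..<m}.
        frob_jac_diff n m p f y w y w' \<le> L1 * L2_set (\<lambda>k. w k - w' k) {..<m} \<and>
        frob_hess_diff n m p f y w y w' \<le> L2 * L2_set (\<lambda>k. w k - w' k) {..<m})"

definition weight_index :: "nat \<Rightarrow> (nat \<Rightarrow> nat) \<Rightarrow> (nat \<times> nat) set" where
  "weight_index N dw = (SIGMA i:{1..N}. {..<dw i})"

definition layer_weight :: "(nat \<times> nat \<Rightarrow> real) \<Rightarrow> nat \<Rightarrow> rvec" where
  "layer_weight W i = (\<lambda>k. W (i, k))"

text \<open>
  Perturbed forward and backward pass at weights \<open>W\<close> and sample \<open>x\<close>. The unperturbed passes are
  obtained with zero perturbations. Below, \<open>d i\<close> is the dimension of the output of layer \<open>i\<close>;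
  the backward perturbation \<open>\<epsilon> i\<close> lives in \<open>\<real>\<^bsup>d (i - 1)\<^esup>\<close>. Only the values of \<open>backward\<close> at
  \<open>1 \<le> i \<le> N\<close> are meaningful.
\<close>

primrec forward ::
  "(nat \<Rightarrow> layer_map) \<Rightarrow> (nat \<times> nat \<Rightarrow> real) \<Rightarrow> rvec \<Rightarrow> (nat \<Rightarrow> rvec) \<Rightarrow> nat \<Rightarrow> rvec" where
  "forward f W x \<delta> 0 = x"
| "forward f W x \<delta> (Suc i) =
     (\<lambda>k. f (Suc i) (forward f W x \<delta> i) (layer_weight W (Suc i)) k + \<delta> (Suc i) k)"

function backward ::
  "nat \<Rightarrow> (nat \<Rightarrow> nat) \<Rightarrow> (nat \<Rightarrow> layer_map) \<Rightarrow> (nat \<times> nat \<Rightarrow> real) \<Rightarrow> (nat \<Rightarrow> rvec) \<Rightarrow>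
   (nat \<Rightarrow> rvec) \<Rightarrow> nat \<Rightarrow> rvec" where
  "backward N d f W y \<epsilon> i =
     (if i < N then
        (\<lambda>k. if k < d i then
               (\<Sum>j<d (Suc i). jac1 (f (Suc i)) (y i) (layer_weight W (Suc i)) j k *
                  backward N d f W y \<epsilon> (Suc i) j) + \<epsilon> (Suc i) k
             else 0)
      else (\<lambda>k. if k = 0 then 1 else 0))"
  by pat_completeness auto
termination
  by (relation "Wellfounded.measure (\<lambda>(N, d, f, W, y, \<epsilon>, i). N - i)") auto

declare backward.simps [simp del]

text \<open>The stacked gradient \<open>(u\<^sub>1, \<dots>, u\<^sub>N)\<close>.\<close>

definition stacked_grad ::
  "nat \<Rightarrow> (nat \<Rightarrow> nat) \<Rightarrow> (nat \<Rightarrow> layer_map) \<Rightarrow> (nat \<times> nat \<Rightarrow> real) \<Rightarrow> rvec \<Rightarrow>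
   (nat \<Rightarrow> rvec) \<Rightarrow> (nat \<Rightarrow> rvec) \<Rightarrow> nat \<times> nat \<Rightarrow> real" where
  "stacked_grad N d f W x \<delta> \<epsilon> = (\<lambda>(i, k).
     \<Sum>j<d i. jac2 (f i) (forward f W x \<delta> (i - 1)) (layer_weight W i) j k *
       backward N d f W (forward f W x \<delta>) \<epsilon> i j)"

text \<open>
  The \<open>\<sigma>\<close>-algebras, given by the real random variables that generate them. \<open>w t\<close>, \<open>x t\<close>, \<open>\<delta> t\<close> and
  \<open>\<epsilon> t\<close> are the weights, the sample and the perturbations of iteration \<open>t\<close>. What is generated up
  to iteration \<open>t\<close> comprises the weights and the sample with which iteration \<open>t\<close> is carried out,
  and the perturbations of the earlier iterations, but not those of iteration \<open>t\<close>.
\<close>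

definition generated_algebra :: "'a measure \<Rightarrow> ('a \<Rightarrow> real) set \<Rightarrow> 'a measure" where
  "generated_algebra M XS = sigma (space M) {X -` B \<inter> space M | X B. X \<in> XS \<and> B \<in> sets borel}"

definition F_generators ::
  "nat \<Rightarrow> (nat \<Rightarrow> nat) \<Rightarrow> (nat \<Rightarrow> nat) \<Rightarrow> (nat \<Rightarrow> 'a \<Rightarrow> nat \<times> nat \<Rightarrow> real) \<Rightarrow> (nat \<Rightarrow> 'a \<Rightarrow> rvec) \<Rightarrow>
   (nat \<Rightarrow> 'a \<Rightarrow> nat \<Rightarrow> rvec) \<Rightarrow> (nat \<Rightarrow> 'a \<Rightarrow> nat \<Rightarrow> rvec) \<Rightarrow> nat \<Rightarrow> ('a \<Rightarrow> real) set" where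
  "F_generators N d dw w x \<delta> \<epsilon> t =
     {(\<lambda>\<omega>. w s \<omega> p) | s p. s \<in> {1..t} \<and> p \<in> weight_index N dw} \<union>
     {(\<lambda>\<omega>. x s \<omega> k) | s k. s \<in> {1..t} \<and> k < d 0} \<union>
     {(\<lambda>\<omega>. \<delta> s \<omega> i k) | s i k. s \<in> {1..<t} \<and> i \<in> {1..N} \<and> k < d i} \<union>
     {(\<lambda>\<omega>. \<epsilon> s \<omega> i k) | s i k. s \<in> {1..<t} \<and> i \<in> {2..N} \<and> k < d (i - 1)}"

definition F_alg where
  "F_alg M N d dw w x \<delta> \<epsilon> t = generated_algebra M (F_generators N d dw w x \<delta> \<epsilon> t)"

definition G_generators ::
  "nat \<Rightarrow> (nat \<Rightarrow> nat) \<Rightarrow> (nat \<Rightarrow> nat) \<Rightarrow> (nat \<Rightarrow> layer_map) \<Rightarrow>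
   (nat \<Rightarrow> 'a \<Rightarrow> nat \<times> nat \<Rightarrow> real) \<Rightarrow> (nat \<Rightarrow> 'a \<Rightarrow> rvec) \<Rightarrow>
   (nat \<Rightarrow> 'a \<Rightarrow> nat \<Rightarrow> rvec) \<Rightarrow> (nat \<Rightarrow> 'a \<Rightarrow> nat \<Rightarrow> rvec) \<Rightarrow> nat \<Rightarrow> nat \<Rightarrow> ('a \<Rightarrow> real) set" where
  "G_generators N d dw f w x \<delta> \<epsilon> t i =
     F_generators N d dw w x \<delta> \<epsilon> t \<union>
     {(\<lambda>\<omega>. forward f (w t \<omega>) (x t \<omega>) (\<delta> t \<omega>) j k) | j k. j \<in> {1..i} \<and> k < d j}"

definition G_alg where
  "G_alg M N d dw f w x \<delta> \<epsilon> t i = generated_algebra M (G_generators N d dw f w x \<delta> \<epsilon> t i)"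

definition H_alg where
  "H_alg M N d dw f w x \<delta> \<epsilon> t i = generated_algebra M
     (G_generators N d dw f w x \<delta> \<epsilon> t N \<union>
      {(\<lambda>\<omega>. backward N d f (w t \<omega>) (forward f (w t \<omega>) (x t \<omega>) (\<delta> t \<omega>)) (\<epsilon> t \<omega>) j k) | j k.
         j \<in> {i..N} \<and> k < d j})"

definition vec_cond_exp ::
  "'a measure \<Rightarrow> 'a measure \<Rightarrow> ('a \<Rightarrow> 'k \<Rightarrow> real) \<Rightarrow> 'a \<Rightarrow> 'k \<Rightarrow> real" where
  "vec_cond_exp M F X = (\<lambda>\<omega> k. real_cond_exp M F (\<lambda>\<omega>. X \<omega> k) \<omega>)"

text \<open>
  Expectation of the \<open>p\<close>-th power of the Euclidean norm, possibly infinite: no finiteness of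
  moments is presupposed.
\<close>

definition norm_moment :: "'a measure \<Rightarrow> nat \<Rightarrow> 'k set \<Rightarrow> ('a \<Rightarrow> 'k \<Rightarrow> real) \<Rightarrow> ennreal" where
  "norm_moment M p K X = (\<integral>\<^sup>+ \<omega>. ennreal (L2_set (X \<omega>) K ^ p) \<partial>M)"

definition Cv :: "nat \<Rightarrow> real \<Rightarrow> real" where
  "Cv N C1 = max 1 (C1 ^ N)"

definition Cb_delta :: "nat \<Rightarrow> real \<Rightarrow> real \<Rightarrow> nat \<Rightarrow> real" where
  "Cb_delta N C1 C2 i =
     8 * C2\<^sup>2 * (Cv N C1)\<^sup>2 *
       (\<Sum>j=i..N - 1. (\<Sum>k=0..j. (3 * C1\<^sup>2) ^ k) * (4 * C1\<^sup>2) ^ (j - i))"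

text \<open>The argument \<open>l\<close> is the full subscript of \<open>\<epsilon>\<close>, i.e. \<open>l = i + 1\<close>.\<close>

definition Cb_eps :: "real \<Rightarrow> nat \<Rightarrow> real" where
  "Cb_eps C1 l = 2 * (\<Sum>j=1..l - 1. (3 * C1\<^sup>2) ^ j)"

definition Cy_sq :: "nat \<Rightarrow> real \<Rightarrow> real \<Rightarrow> real \<Rightarrow> real \<Rightarrow> nat \<Rightarrow> real" where
  "Cy_sq N C1 C2 L1 L2 i =
     8 * C2\<^sup>2 * L1\<^sup>2 * (Cv N C1)\<^sup>2 *
       (\<Sum>j=i + 1..N - 1. (\<Sum>k=0..j. (3 * C1\<^sup>2) ^ k) * (4 * C1\<^sup>2) ^ (j - i - 1)) +
     2 * L2\<^sup>2 * (Cv N C1)\<^sup>2 * (\<Sum>j=0..i. (3 * C1\<^sup>2) ^ j)"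

definition Cb_delta4 :: "nat \<Rightarrow> real \<Rightarrow> real \<Rightarrow> real \<Rightarrow> real \<Rightarrow> real \<Rightarrow> nat \<Rightarrow> real" where
  "Cb_delta4 N C1 C2 Lf L1 L2 i =
     8 * (\<Sum>j=i..N - 1. Cy_sq N C1 C2 L1 L2 j * (8 * Lf ^ 4) ^ (j - i))"

end

theory Submission
  imports Defs
begin

text \<open>
  Split the gradient error at the gradient that uses the perturbed forward pass but the exact backward
  pass on it. The conditional mean given \<open>G\<^sub>N\<close> of the error caused by the backward perturbations obeys the
  backward recursion driven by the conditional means of the perturbations, so the norm bounds on the
  Jacobians and Jensen's inequality control it by the last sum.

  The error caused by the forward perturbations is estimated pointwise. As \<open>G\<^sub>i\<close> contains the perturbed
  output of layer \<open>i\<close>, hence \<open>\<delta>\<^sub>i\<close> itself, \<open>\<delta>\<^sub>i\<close> is its own conditional expectation, and a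
  first-order (Lipschitz) estimate with the second-derivative bounds already gives the first sum; the
  fourth-moment sum is nonnegative and is just added.
\<close>

subsection \<open>The operator norm\<close>

text \<open>Two demands force the conditioning on \<open>G N\<close> in the backward part. The
  Jacobians at the perturbed forward outputs are measurable there, so they act as constants and the
  error recursion keeps its coefficients. And \<open>G N\<close> lies between F^(t) and every
  H_{i+1}, so the tower property and Jensen lead from the first to the second.

  The forward part has to bound vectors by operator norms of second derivatives, although the mean
  value theorem is an identity only for scalar functions. The remedy is to pair the error with
  itself, use the scalar theorem, and cancel one factor of the norm.

  Each split (a+b)^2 <= 2a^2 + 2b^2 costs a factor 2. The recursions thus have ratio 2 C1^2,
  enlarged to 3 C1^2 and 4 C1^2 only at the end. The prefactor 8 of \<open>Cb_delta\<close> consists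
  of three splits: at the intermediate gradient, at the Jacobian difference, and in the forward
  recursion. The prefactor 2 of \<open>Cb_eps\<close> is the split at which the perturbation enters;
  the split at the intermediate gradient is absorbed by one power of the ratio. Perturbations are
  only integrable, so moments are compared in [0, infinity].\<close>

lemma L2_set_power2: "(L2_set g K)\<^sup>2 = (\<Sum>k\<in>K. (g k)\<^sup>2)"
  by (simp add: L2_set_def sum_nonneg)

lemma abs_sum_mult_le_L2_set:
  "\<bar>\<Sum>k\<in>K. g k * h k\<bar> \<le> L2_set g K * L2_set h K"
proof -
  have "\<bar>\<Sum>k\<in>K. g k * h k\<bar> \<le> (\<Sum>k\<in>K. \<bar>g k\<bar> * \<bar>h k\<bar>)"
    by (metis (no_types, lifting) abs_mult sum.cong sum_abs)
  also have "\<dots> \<le> L2_set g K * L2_set h K"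
    by (rule L2_set_mult_ineq)
  finally show ?thesis .
qed

lemma L2_set_abs_scale: "L2_set (\<lambda>k. c * g k) K = \<bar>c\<bar> * L2_set g K"
proof -
  have "L2_set (\<lambda>k. c * g k) K = L2_set (\<lambda>k. \<bar>c\<bar> * g k) K"
    by (simp add: L2_set_def power_mult_distrib)
  then show ?thesis
    by (simp add: L2_set_right_distrib)
qed

lemma L2_set_mult_le_op_norm:
  assumes K: "finite K"
  shows "L2_set (\<lambda>i. \<Sum>k\<in>K. A i k * x k) I \<le> op_norm I K A * L2_set x K"
proof (cases "L2_set x K = 0")
  case True
  then show ?thesis
    using K by (simp add: L2_set_eq_0_iff L2_set_0')
next
  case False
  define c where "c = L2_set x K"
  define x' where "x' = (\<lambda>k. if k \<in> K then inverse c * x k else 0)"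
  have c: "c > 0"
    using False L2_set_nonneg[of x K] unfolding c_def by linarith
  have "L2_set x' K = L2_set (\<lambda>k. inverse c * x k) K"
    by (intro L2_set_cong) (auto simp: x'_def)
  also have "\<dots> = 1"
    using c by (simp add: L2_set_abs_scale c_def)
  finally have x': "x' \<in> {x \<in> vecs K. L2_set x K = 1}"
    by (simp add: x'_def vecs_def)
  \<comment> \<open>A supremum over reals bounds its members only when the set is bounded above. On
    the unit sphere the sum of the row norms is a crude bound, by Cauchy-Schwarz in each
    row.\<close>
  have "L2_set (\<lambda>i. \<Sum>k\<in>K. A i k * z k) I \<le> (\<Sum>i\<in>I. L2_set (A i) K)"
    if "L2_set z K = 1" for z
  proof -
    have "L2_set (\<lambda>i. \<Sum>k\<in>K. A i k * z k) I \<le> (\<Sum>i\<in>I. \<bar>\<Sum>k\<in>K. A i k * z k\<bar>)"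
      by (rule L2_set_le_sum_abs)
    also have "\<dots> \<le> (\<Sum>i\<in>I. L2_set (A i) K * L2_set z K)"
      by (intro sum_mono abs_sum_mult_le_L2_set)
    finally show ?thesis
      using that by simp
  qed
  then have "bdd_above ((\<lambda>x. L2_set (\<lambda>i. \<Sum>k\<in>K. A i k * x k) I) ` {x \<in> vecs K. L2_set x K = 1})"
    by (auto intro!: bdd_aboveI)
  then have "L2_set (\<lambda>i. \<Sum>k\<in>K. A i k * x' k) I \<le> op_norm I K A"
    unfolding op_norm_def by (rule cSUP_upper[OF x'])
  moreover have "L2_set (\<lambda>i. \<Sum>k\<in>K. A i k * x' k) I
      = L2_set (\<lambda>i. inverse c * (\<Sum>k\<in>K. A i k * x k)) I"
    by (simp add: x'_def sum_distrib_left mult_ac)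
  ultimately have "inverse c * L2_set (\<lambda>i. \<Sum>k\<in>K. A i k * x k) I \<le> op_norm I K A"
    using c by (simp only: L2_set_abs_scale) simp
  then show ?thesis
    using c unfolding c_def[symmetric] by (simp add: field_simps)
qed

lemma L2_set_mult_le:
  assumes "finite K" "op_norm I K A \<le> C"
  shows "L2_set (\<lambda>i. \<Sum>k\<in>K. A i k * x k) I \<le> C * L2_set x K"
  using L2_set_mult_le_op_norm[OF assms(1), of A x I] mult_right_mono[OF assms(2) L2_set_nonneg[of x K]]
  by linarith

text \<open>Duality: for z = A^T v one has |z|^2 = <v, A z> <= |v| C |z|, and a factor |z| cancels.
  The backward pass multiplies by transposed Jacobians, while the hypotheses bound the Jacobians
  themselves. The sign of \<open>C\<close> matters in the case z = 0.\<close>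

lemma L2_set_transpose_mult_le:
  assumes "finite K" "op_norm I K A \<le> C" "0 \<le> C"
  shows "L2_set (\<lambda>k. \<Sum>i\<in>I. A i k * v i) K \<le> C * L2_set v I"
proof -
  define z where "z = (\<lambda>k. \<Sum>i\<in>I. A i k * v i)"
  have "L2_set z K * L2_set z K = (\<Sum>k\<in>K. z k * z k)"
    by (simp add: L2_set_power2 flip: power2_eq_square)
  also have "\<dots> = (\<Sum>i\<in>I. v i * (\<Sum>k\<in>K. A i k * z k))"
    unfolding z_def sum_distrib_left sum_distrib_right
    by (subst sum.swap) (simp add: mult_ac)
  also have "\<dots> \<le> L2_set v I * L2_set (\<lambda>i. \<Sum>k\<in>K. A i k * z k) I"
    using abs_sum_mult_le_L2_set[of v "\<lambda>i. \<Sum>k\<in>K. A i k * z k" I] by linarith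
  also have "\<dots> \<le> L2_set v I * (C * L2_set z K)"
    by (intro mult_left_mono L2_set_mult_le assms L2_set_nonneg)
  finally have "L2_set z K * L2_set z K \<le> (C * L2_set v I) * L2_set z K"
    by (simp add: mult_ac)
  show ?thesis
  proof (cases "L2_set z K = 0")
    case True
    then show ?thesis using assms(3) unfolding z_def by simp
  next
    case False
    then have "L2_set z K > 0"
      using L2_set_nonneg[of z K] by linarith
    then show ?thesis
      using \<open>L2_set z K * L2_set z K \<le> (C * L2_set v I) * L2_set z K\<close> unfolding z_def by simp
  qed
qed

text \<open>The matrix is tested on a unit coordinate vector. Entrywise bounds make the Jacobian
  entries bounded random coefficients, whose products with integrable variables are
  integrable.\<close>

lemma abs_entry_le_op_norm:
  assumes "finite I" "finite K" "op_norm I K A \<le> C" "i \<in> I" "k \<in> K"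
  shows "\<bar>A i k\<bar> \<le> C"
proof -
  define e where "e = (\<lambda>j. if j = k then 1 else 0 :: real)"
  have "L2_set e K = sqrt (\<Sum>j\<in>K. if j = k then 1 else 0)"
    unfolding L2_set_def e_def by (intro arg_cong[where f = sqrt] sum.cong) auto
  then have e: "L2_set e K = 1"
    using assms by simp
  have "(\<Sum>j\<in>K. A i j * e j) = A i k" for i
    using assms by (simp add: e_def if_distrib[of "\<lambda>x. _ * x"] cong: if_cong)
  then have "L2_set (\<lambda>i. A i k) I \<le> C"
    using L2_set_mult_le[OF assms(2,3), of e] e by simp
  moreover have "\<bar>A i k\<bar> \<le> L2_set (\<lambda>i. \<bar>A i k\<bar>) I"
    using member_le_L2_set[OF assms(1,4), of "\<lambda>i. \<bar>A i k\<bar>"] by simp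
  moreover have "L2_set (\<lambda>i. \<bar>A i k\<bar>) I = L2_set (\<lambda>i. A i k) I"
    by (simp add: L2_set_def)
  ultimately show ?thesis by linarith
qed

subsection \<open>Differentiable functions on finite-dimensional index spaces\<close>

lemma vecs_lin: "x \<in> vecs K \<Longrightarrow> h \<in> vecs K \<Longrightarrow> (\<lambda>k. x k + s * h k) \<in> vecs K"
  by (simp add: vecs_def)

lemma frechet_has_directional_derivative:
  assumes "\<And>e. e > 0 \<Longrightarrow> \<exists>r>0. \<forall>x'\<in>vecs K. L2_set (\<lambda>k. x' k - (x k + s * h k)) K < r \<longrightarrow>
        \<bar>g x' - g (\<lambda>k. x k + s * h k) - (\<Sum>k\<in>K. a k * (x' k - (x k + s * h k)))\<bar>
          \<le> e * L2_set (\<lambda>k. x' k - (x k + s * h k)) K"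
    and "x \<in> vecs K" "h \<in> vecs K"
  shows "((\<lambda>s. g (\<lambda>k. x k + s * h k)) has_real_derivative (\<Sum>k\<in>K. a k * h k)) (at s)"
  unfolding has_field_derivative_iff LIM_def
proof (intro allI impI)
  fix e :: real assume "e > 0"
  define H where "H = L2_set h K"
  have H: "H \<ge> 0" by (simp add: H_def)
  \<comment> \<open>Dividing by \<open>H + 1\<close> instead of \<open>H\<close> covers the
    direction h = 0 and makes the final inequality strict.\<close>
  obtain r where r: "r > 0" "\<And>x'. x'\<in>vecs K \<Longrightarrow> L2_set (\<lambda>k. x' k - (x k + s * h k)) K < r \<Longrightarrow>
        \<bar>g x' - g (\<lambda>k. x k + s * h k) - (\<Sum>k\<in>K. a k * (x' k - (x k + s * h k)))\<bar>
          \<le> e / (H + 1) * L2_set (\<lambda>k. x' k - (x k + s * h k)) K"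
    using assms(1)[of "e / (H + 1)"] H \<open>e > 0\<close> by auto
  show "\<exists>r>0. \<forall>u. u \<noteq> s \<and> dist u s < r \<longrightarrow>
    dist ((g (\<lambda>k. x k + u * h k) - g (\<lambda>k. x k + s * h k)) / (u - s)) (\<Sum>k\<in>K. a k * h k) < e"
  proof (intro exI[of _ "r / (H + 1)"] conjI allI impI)
    show "r / (H + 1) > 0" using r H by simp
    fix u assume u: "u \<noteq> s \<and> dist u s < r / (H + 1)"
    have eq: "x k + u * h k - (x k + s * h k) = (u - s) * h k" for k
      by (simp add: algebra_simps)
    have L: "L2_set (\<lambda>k. x k + u * h k - (x k + s * h k)) K = \<bar>u - s\<bar> * H"
      unfolding eq L2_set_abs_scale H_def ..
    have S: "(\<Sum>k\<in>K. a k * (x k + u * h k - (x k + s * h k))) = (u - s) * (\<Sum>k\<in>K. a k * h k)"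
      unfolding eq sum_distrib_left by (simp add: mult_ac)
    have "\<bar>u - s\<bar> * H \<le> \<bar>u - s\<bar> * (H + 1)"
      by (simp add: mult_left_mono)
    also have "\<dots> < r"
      using u H by (simp add: dist_real_def field_simps)
    finally have "\<bar>g (\<lambda>k. x k + u * h k) - g (\<lambda>k. x k + s * h k) - (u - s) * (\<Sum>k\<in>K. a k * h k)\<bar>
        \<le> e / (H + 1) * (\<bar>u - s\<bar> * H)"
      using r(2)[OF vecs_lin[OF assms(2,3)], of u] unfolding L S by simp
    also have "\<dots> < e * \<bar>u - s\<bar>"
      using u H \<open>e > 0\<close> by (simp add: field_simps)
    finally have *: "\<bar>g (\<lambda>k. x k + u * h k) - g (\<lambda>k. x k + s * h k) - (u - s) * (\<Sum>k\<in>K. a k * h k)\<bar>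
        < e * \<bar>u - s\<bar>" .
    have "(g (\<lambda>k. x k + u * h k) - g (\<lambda>k. x k + s * h k)) / (u - s) - (\<Sum>k\<in>K. a k * h k)
        = (g (\<lambda>k. x k + u * h k) - g (\<lambda>k. x k + s * h k) - (u - s) * (\<Sum>k\<in>K. a k * h k)) / (u - s)"
      using u by (simp add: field_simps)
    then show "dist ((g (\<lambda>k. x k + u * h k) - g (\<lambda>k. x k + s * h k)) / (u - s)) (\<Sum>k\<in>K. a k * h k) < e"
      using * u by (simp add: dist_real_def divide_less_eq)
  qed
qed

lemma frechet_diff_at_directional:
  assumes K: "finite K"
    and g: "frechet_diff_at K g (\<lambda>k. x k + s * h k)"
    and x: "x \<in> vecs K" and h: "h \<in> vecs K"
  shows "((\<lambda>s. g (\<lambda>k. x k + s * h k)) has_real_derivative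
    (\<Sum>k\<in>K. partial g k (\<lambda>k. x k + s * h k) * h k)) (at s)"
proof -
  define z where "z = (\<lambda>k. x k + s * h k)"
  obtain a where a: "\<And>e. e > 0 \<Longrightarrow> \<exists>r>0. \<forall>x'\<in>vecs K. L2_set (\<lambda>k. x' k - z k) K < r \<longrightarrow>
        \<bar>g x' - g z - (\<Sum>k\<in>K. a k * (x' k - z k))\<bar> \<le> e * L2_set (\<lambda>k. x' k - z k) K"
    using g unfolding frechet_diff_at_def z_def by blast
  have z: "z \<in> vecs K"
    unfolding z_def by (rule vecs_lin[OF x h])
  have "partial g k z = a k" if "k \<in> K" for k
  proof -
    define e where "e = (\<lambda>j. if j = k then 1 else 0 :: real)"
    \<comment> \<open>With coordinate \<open>k\<close> erased, \<open>z(k := s)\<close> is exactly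
      the point of the line from \<open>z0\<close> in direction \<open>e\<close> at parameter
      \<open>s\<close>. Its derivative at \<open>s = z k\<close> is then literally
      \<open>partial g k z\<close>, which identifies the unknown coefficient
      \<open>a k\<close>.\<close>
    define z0 where "z0 = z(k := 0)"
    have eq: "z0 j + z k * e j = z j" for j
      by (auto simp: z0_def e_def)
    have upd: "z(k := s) = (\<lambda>j. z0 j + s * e j)" for s
      by (auto simp: z0_def e_def)
    have "((\<lambda>s. g (\<lambda>j. z0 j + s * e j)) has_real_derivative (\<Sum>j\<in>K. a j * e j)) (at (z k))"
    proof (rule frechet_has_directional_derivative)
      show "z0 \<in> vecs K" "e \<in> vecs K"
        using z that by (auto simp: z0_def e_def vecs_def)
    qed (use a in \<open>simp add: eq\<close>)
    moreover have "(\<Sum>j\<in>K. a j * e j) = a k"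
      using that K by (simp add: e_def if_distrib[of "\<lambda>x. _ * x"] cong: if_cong)
    ultimately show ?thesis
      unfolding partial_def upd by (metis DERIV_imp_deriv)
  qed
  then have "(\<Sum>k\<in>K. partial g k z * h k) = (\<Sum>k\<in>K. a k * h k)"
    by (intro sum.cong) auto
  then show ?thesis
    using frechet_has_directional_derivative[OF a[unfolded z_def] x h]
    unfolding z_def by simp
qed

text \<open>For a vector-valued map the components have different intermediate points. A fixed
  linear combination of them is one scalar function on the segment, so a single \<open>s\<close>
  serves all components.\<close>

lemma mean_value_sum:
  assumes K: "finite K"
    and G: "\<And>j z. j \<in> I \<Longrightarrow> z \<in> vecs K \<Longrightarrow> frechet_diff_at K (G j) z"
    and x: "x \<in> vecs K" and h: "h \<in> vecs K"
  obtains s :: real where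
    "(\<Sum>j\<in>I. c j * (G j (\<lambda>k. x k + h k) - G j x))
       = (\<Sum>j\<in>I. c j * (\<Sum>k\<in>K. partial (G j) k (\<lambda>k. x k + s * h k) * h k))"
proof -
  define \<phi> where "\<phi> s = (\<Sum>j\<in>I. c j * G j (\<lambda>k. x k + s * h k))" for s
  have "(\<phi> has_real_derivative (\<Sum>j\<in>I. c j * (\<Sum>k\<in>K. partial (G j) k (\<lambda>k. x k + s * h k) * h k))) (at s)"
    for s
    unfolding \<phi>_def
    by (intro DERIV_sum DERIV_cmult frechet_diff_at_directional K x h G vecs_lin)
  then have "\<exists>s>0. s < 1 \<and> \<phi> 1 - \<phi> 0 =
      (1 - 0) * (\<Sum>j\<in>I. c j * (\<Sum>k\<in>K. partial (G j) k (\<lambda>k. x k + s * h k) * h k))"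
    by (intro MVT2) auto
  then obtain s where "\<phi> 1 - \<phi> 0 =
      (\<Sum>j\<in>I. c j * (\<Sum>k\<in>K. partial (G j) k (\<lambda>k. x k + s * h k) * h k))"
    by auto
  then show thesis
    by (intro that[of s]) (simp add: \<phi>_def right_diff_distrib sum_subtractf)
qed

lemma frechet_diff_at_tendsto:
  assumes K: "finite K" and g: "frechet_diff_at K g z"
    and X: "\<And>n. X n \<in> vecs K" and lim: "\<And>k. k \<in> K \<Longrightarrow> (\<lambda>n. X n k) \<longlonglongrightarrow> z k"
  shows "(\<lambda>n. g (X n)) \<longlonglongrightarrow> g z"
proof -
  obtain a r where r: "r > 0" and a: "\<And>x'. x' \<in> vecs K \<Longrightarrow> L2_set (\<lambda>k. x' k - z k) K < r \<Longrightarrow>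
        \<bar>g x' - g z - (\<Sum>k\<in>K. a k * (x' k - z k))\<bar> \<le> 1 * L2_set (\<lambda>k. x' k - z k) K"
    using g unfolding frechet_diff_at_def by (meson zero_less_one)
  \<comment> \<open>The sum of the absolute displacements tends to 0 as a finite sum of null
    sequences, and it dominates the Euclidean norm that occurs in the definition of
    differentiability.\<close>
  define e where "e n = (\<Sum>k\<in>K. \<bar>X n k - z k\<bar>)" for n
  define b where "b n = (\<Sum>k\<in>K. a k * (X n k - z k))" for n
  have diff: "(\<lambda>n. X n k - z k) \<longlonglongrightarrow> 0" if "k \<in> K" for k
    using lim[OF that] by (simp add: LIM_zero_iff)
  have e: "e \<longlonglongrightarrow> 0"
    unfolding e_def by (intro tendsto_null_sum tendsto_rabs_zero diff)
  have b: "b \<longlonglongrightarrow> 0"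
    unfolding b_def by (intro tendsto_null_sum tendsto_mult_right_zero diff)
  have "(\<lambda>n. g (X n) - g z) \<longlonglongrightarrow> 0"
  proof (rule Lim_null_comparison)
    show "(\<lambda>n. \<bar>b n\<bar> + e n) \<longlonglongrightarrow> 0"
      using tendsto_add[OF tendsto_rabs_zero[OF b] e] by simp
    show "\<forall>\<^sub>F n in sequentially. norm (g (X n) - g z) \<le> \<bar>b n\<bar> + e n"
      using order_tendstoD(2)[OF e r]
    proof eventually_elim
      case (elim n)
      have "L2_set (\<lambda>k. X n k - z k) K \<le> e n"
        unfolding e_def by (rule L2_set_le_sum_abs)
      then show ?case
        using a[OF X[of n]] elim unfolding b_def by simp
    qed
  qed
  then show ?thesis
    by (simp add: LIM_zero_iff)
qed

text \<open>Differentiability gives continuity, but only on \<open>vecs K\<close>; precomposing with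
  the projection \<open>p\<close> onto \<open>vecs K\<close> yields a function continuous on the
  whole product space. Countability of the index type makes that space first countable, so sequences
  suffice, and lets measurability of the inner map be checked coordinate by coordinate.\<close>

lemma borel_measurable_differentiable:
  fixes X :: "'a \<Rightarrow> 'k :: countable \<Rightarrow> real"
  assumes K: "finite K" and g: "\<And>z. z \<in> vecs K \<Longrightarrow> frechet_diff_at K g z"
    and X: "\<And>\<omega>. \<omega> \<in> space F \<Longrightarrow> X \<omega> \<in> vecs K"
    and meas: "\<And>k. k \<in> K \<Longrightarrow> (\<lambda>\<omega>. X \<omega> k) \<in> borel_measurable F"
  shows "(\<lambda>\<omega>. g (X \<omega>)) \<in> borel_measurable F"
proof -
  define p where "p = (\<lambda>(z :: 'k \<Rightarrow> real) k. if k \<in> K then z k else 0)"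
  have p: "p z \<in> vecs K" for z
    by (simp add: p_def vecs_def)
  have "continuous_on UNIV (\<lambda>z. g (p z))"
  proof (rule continuous_on_sequentiallyI)
    fix u :: "nat \<Rightarrow> 'k \<Rightarrow> real" and z assume u: "u \<longlonglongrightarrow> z"
    have "(\<lambda>n. u n k) \<longlonglongrightarrow> z k" for k
      by (rule continuous_on_tendsto_compose[OF continuous_on_product_coordinates[of k] u]) auto
    then show "(\<lambda>n. g (p (u n))) \<longlonglongrightarrow> g (p z)"
      by (intro frechet_diff_at_tendsto[OF K g[OF p] p]) (simp add: p_def)
  qed
  then have "(\<lambda>z. g (p z)) \<in> borel_measurable borel"
    by (rule borel_measurable_continuous_onI)
  moreover have "(\<lambda>\<omega>. p (X \<omega>)) \<in> borel_measurable F"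
  proof (rule measurable_coordinatewise_then_product)
    show "(\<lambda>\<omega>. p (X \<omega>) k) \<in> borel_measurable F" for k
      by (cases "k \<in> K") (simp_all add: p_def meas)
  qed
  ultimately have "(\<lambda>\<omega>. g (p (p (X \<omega>)))) \<in> borel_measurable F"
    by (rule measurable_compose_rev)
  moreover have "p (p (X \<omega>)) = X \<omega>" if "\<omega> \<in> space F" for \<omega>
    using X[OF that] by (auto simp: p_def vecs_def)
  ultimately show ?thesis
    by (simp cong: measurable_cong)
qed

text \<open>Partial derivatives of a merely differentiable function need not be continuous, but they
  are pointwise limits of difference quotients with steps 1/(n+1). This serves the regularizer
  \<open>R\<close>, whose gradient enters the weight update.\<close>

lemma borel_measurable_partial:
  fixes X :: "'a \<Rightarrow> 'k :: countable \<Rightarrow> real"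
  assumes K: "finite K" and g: "\<And>z. z \<in> vecs K \<Longrightarrow> frechet_diff_at K g z"
    and X: "\<And>\<omega>. \<omega> \<in> space F \<Longrightarrow> X \<omega> \<in> vecs K"
    and meas: "\<And>k. k \<in> K \<Longrightarrow> (\<lambda>\<omega>. X \<omega> k) \<in> borel_measurable F"
    and k: "k \<in> K"
  shows "(\<lambda>\<omega>. partial g k (X \<omega>)) \<in> borel_measurable F"
proof (rule borel_measurable_LIMSEQ_real)
  define e where "e = (\<lambda>j. if j = k then 1 else 0 :: real)"
  define s where "s = (\<lambda>n. inverse (real (Suc n)))"
  have e: "e \<in> vecs K"
    using k by (auto simp: e_def vecs_def)
  show "(\<lambda>\<omega>. (g (\<lambda>j. X \<omega> j + s n * e j) - g (X \<omega>)) / s n) \<in> borel_measurable F" for n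
  proof (intro borel_measurable_divide borel_measurable_diff borel_measurable_const)
    show "(\<lambda>\<omega>. g (\<lambda>j. X \<omega> j + s n * e j)) \<in> borel_measurable F"
      by (rule borel_measurable_differentiable[OF K g])
        (auto intro!: vecs_lin X e borel_measurable_add meas)
    show "(\<lambda>\<omega>. g (X \<omega>)) \<in> borel_measurable F"
      by (rule borel_measurable_differentiable[OF K g X meas])
  qed
  fix \<omega> assume \<omega>: "\<omega> \<in> space F"
  have "((\<lambda>s. g (\<lambda>j. X \<omega> j + s * e j)) has_real_derivative
      (\<Sum>j\<in>K. partial g j (\<lambda>j. X \<omega> j + 0 * e j) * e j)) (at 0)"
    using \<omega> by (intro frechet_diff_at_directional K g X e vecs_lin)
  moreover have "(\<Sum>j\<in>K. partial g j (X \<omega>) * e j) = partial g k (X \<omega>)"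
    using k K by (simp add: e_def if_distrib[of "\<lambda>x. _ * x"] cong: if_cong)
  ultimately have D: "((\<lambda>h. (g (\<lambda>j. X \<omega> j + h * e j) - g (X \<omega>)) / h) \<longlongrightarrow> partial g k (X \<omega>)) (at 0)"
    by (simp add: DERIV_def)
  have "filterlim s (at 0) sequentially"
    unfolding filterlim_at using LIMSEQ_inverse_real_of_nat unfolding s_def by auto
  from filterlim_compose[OF D this]
  show "(\<lambda>n. (g (\<lambda>j. X \<omega> j + s n * e j) - g (X \<omega>)) / s n) \<longlonglongrightarrow> partial g k (X \<omega>)" .
qed

subsection \<open>Mean value estimates for one layer\<close>

lemma case_sum_vecs:
  fixes y w :: rvec
  shows
  "y \<in> vecs {..<n} \<Longrightarrow> w \<in> vecs {..<m} \<Longrightarrow> case_sum y w \<in> vecs ({..<n} <+> {..<m})"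
  by (auto simp: vecs_def split: sum.split)

text \<open>The displacement has weight part 0, so only the partials with index \<open>Inl\<close>
  survive. Of the intermediate point it is enough to know that it lies in the domain, since the
  derivative bounds hold everywhere.\<close>

lemma mean_value_first_argument:
  fixes y y' w :: rvec
  assumes G: "\<And>j z. j \<in> I \<Longrightarrow> z \<in> vecs ({..<n} <+> {..<m}) \<Longrightarrow> frechet_diff_at ({..<n} <+> {..<m}) (G j) z"
    and y: "y \<in> vecs {..<n}" "y' \<in> vecs {..<n}" and w: "w \<in> vecs {..<m}"
  obtains y0 where "y0 \<in> vecs {..<n}"
    "(\<Sum>j\<in>I. c j * (G j (case_sum y' w) - G j (case_sum y w)))
      = (\<Sum>j\<in>I. c j * (\<Sum>\<beta><n. partial (G j) (Inl \<beta>) (case_sum y0 w) * (y' \<beta> - y \<beta>)))"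
proof -
  define h where "h = case_sum (\<lambda>k. y' k - y k) (\<lambda>_ :: nat. 0 :: real)"
  have "h \<in> vecs ({..<n} <+> {..<m})"
    using y unfolding h_def by (intro case_sum_vecs) (auto simp: vecs_def)
  with assms obtain s where s:
    "(\<Sum>j\<in>I. c j * (G j (\<lambda>k. case_sum y w k + h k) - G j (case_sum y w)))
       = (\<Sum>j\<in>I. c j * (\<Sum>k\<in>{..<n} <+> {..<m}. partial (G j) k (\<lambda>k. case_sum y w k + s * h k) * h k))"
    using mean_value_sum[of "{..<n} <+> {..<m}" I G "case_sum y w" h c] case_sum_vecs[OF y(1) w]
    by (metis finite_Plus finite_lessThan)
  have "(\<lambda>k. case_sum y w k + h k) = case_sum y' w"
    and eq: "(\<lambda>k. case_sum y w k + s * h k) = case_sum (\<lambda>k. y k + s * (y' k - y k)) w"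
    by (auto simp: h_def fun_eq_iff split: sum.split)
  moreover have "(\<Sum>k\<in>{..<n} <+> {..<m}. partial g k z * h k)
      = (\<Sum>\<beta><n. partial g (Inl \<beta>) z * (y' \<beta> - y \<beta>))" for g and z :: "nat + nat \<Rightarrow> real"
    by (simp add: sum.Plus h_def)
  ultimately show thesis
    using s y by (intro that[of "\<lambda>k. y k + s * (y' k - y k)"]) (auto simp: vecs_def)
qed

lemma self_bound_cancel:
  fixes a b :: real
  assumes "a * a \<le> b * a" "0 \<le> a" "0 \<le> b"
  shows "a \<le> b"
  using assms by (cases "a = 0") auto

lemma power2_add_le: "(a + b)\<^sup>2 \<le> 2 * a\<^sup>2 + 2 * b\<^sup>2" for a b :: real
  using zero_le_power2[of "a - b"] by (simp add: power2_sum power2_diff)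

text \<open>The components of the error \<open>g\<close> serve as the weights of the scalar mean
  value theorem, so the left side becomes |g|^2 and one |g| cancels. Obtaining the constant from the
  Jacobian bound puts powers of \<open>C1\<close> into the forward recursion, as in
  \<open>Cb_delta\<close>.\<close>

lemma twice_diff_operator_lipschitz:
  assumes f: "twice_diff_operator n m p f"
    and bound: "\<And>y. y \<in> vecs {..<n} \<Longrightarrow> op_norm {..<p} {..<n} (jac1 f y w) \<le> C"
    and C: "0 \<le> C"
    and y: "y \<in> vecs {..<n}" "y' \<in> vecs {..<n}" and w: "w \<in> vecs {..<m}"
  shows "L2_set (\<lambda>j. f y' w j - f y w j) {..<p} \<le> C * L2_set (\<lambda>k. y' k - y k) {..<n}"
proof -
  define g where "g = (\<lambda>j. f y' w j - f y w j)"
  have comp: "comp_fun f j (case_sum y w) = f y w j" for j y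
    by (simp add: comp_fun_def comp_def)
  have diff: "frechet_diff_at ({..<n} <+> {..<m}) (comp_fun f j) z"
    if "j \<in> {..<p}" "z \<in> vecs ({..<n} <+> {..<m})" for j z
    using f that by (auto simp: twice_diff_operator_def)
  obtain y0 where y0: "y0 \<in> vecs {..<n}"
    "(\<Sum>j<p. g j * (comp_fun f j (case_sum y' w) - comp_fun f j (case_sum y w)))
      = (\<Sum>j<p. g j * (\<Sum>\<beta><n. partial (comp_fun f j) (Inl \<beta>) (case_sum y0 w) * (y' \<beta> - y \<beta>)))"
    by (rule mean_value_first_argument[where I = "{..<p}" and G = "comp_fun f" and c = g, OF diff y w])
  have "L2_set g {..<p} * L2_set g {..<p} = (\<Sum>j<p. g j * g j)"
    by (simp add: L2_set_power2 flip: power2_eq_square)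
  also have "\<dots> = (\<Sum>j<p. g j * (\<Sum>\<beta><n. jac1 f y0 w j \<beta> * (y' \<beta> - y \<beta>)))"
    using y0(2) unfolding comp jac1_def jac_def by (simp add: g_def)
  also have "\<dots> \<le> L2_set g {..<p} * L2_set (\<lambda>j. \<Sum>\<beta><n. jac1 f y0 w j \<beta> * (y' \<beta> - y \<beta>)) {..<p}"
    by (rule order_trans[OF abs_ge_self abs_sum_mult_le_L2_set])
  also have "\<dots> \<le> L2_set g {..<p} * (C * L2_set (\<lambda>k. y' k - y k) {..<n})"
    by (rule mult_left_mono[OF L2_set_mult_le[OF finite_lessThan bound[OF y0(1)]] L2_set_nonneg])
  finally have *: "L2_set g {..<p} * L2_set g {..<p} \<le> (C * L2_set (\<lambda>k. y' k - y k) {..<n}) * L2_set g {..<p}"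
    by (simp add: mult_ac)
  show ?thesis
    using self_bound_cancel[OF *] C unfolding g_def by simp
qed

lemma L2_set_Times: "L2_set (\<lambda>(a, b). z a * h b) (A \<times> B) = L2_set z A * L2_set h B"
  by (simp add: L2_set_def power_mult_distrib sum_product sum.cartesian_product case_prod_unfold
      flip: real_sqrt_mult)

text \<open>The map \<open>c\<close> selects the coordinates of differentiation: \<open>Inl\<close>
  gives the Jacobian in the layer input, \<open>Inr\<close> the one in the weights, so one proof
  covers both. For the vector z to be bounded, |z|^2 is a combination of entry differences with
  weights v_j z_\<alpha>. The scalar mean value theorem turns it into the second-derivative tensor
  at one point, applied to the rank-one matrix z h^T and paired with v. The Frobenius norm of z h^T
  is |z| |h|, so one |z| cancels.\<close>

lemma jac_transpose_difference:
  fixes q :: nat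
  assumes f: "twice_diff_operator n m p f"
    and c: "\<And>\<alpha>. \<alpha> < q \<Longrightarrow> c \<alpha> \<in> {..<n} <+> {..<m}"
    and bound: "\<And>y. y \<in> vecs {..<n} \<Longrightarrow>
      op_norm {..<p} ({..<q} \<times> {..<n}) (\<lambda>j (\<alpha>, \<beta>). hess f (case_sum y w) j (c \<alpha>) (Inl \<beta>)) \<le> C"
    and C: "0 \<le> C"
    and y: "y \<in> vecs {..<n}" "y' \<in> vecs {..<n}" and w: "w \<in> vecs {..<m}"
  shows "L2_set (\<lambda>\<alpha>. \<Sum>j<p. (jac f (case_sum y' w) j (c \<alpha>) - jac f (case_sum y w) j (c \<alpha>)) * v j) {..<q}
    \<le> C * L2_set v {..<p} * L2_set (\<lambda>k. y' k - y k) {..<n}"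
proof -
  define z where "z = (\<lambda>\<alpha>. \<Sum>j<p. (jac f (case_sum y' w) j (c \<alpha>) - jac f (case_sum y w) j (c \<alpha>)) * v j)"
  define h where "h = (\<lambda>k. y' k - y k)"
  define I where "I = {..<p} \<times> {..<q}"
  define G where "G = (\<lambda>(j, \<alpha>) z'. jac f z' j (c \<alpha>))"
  have diff: "frechet_diff_at ({..<n} <+> {..<m}) (G i) z"
    if "i \<in> I" "z \<in> vecs ({..<n} <+> {..<m})" for i z
    using f that c by (auto simp: twice_diff_operator_def G_def I_def)
  obtain y0 where y0: "y0 \<in> vecs {..<n}"
    "(\<Sum>i\<in>I. (case i of (j, \<alpha>) \<Rightarrow> v j * z \<alpha>) * (G i (case_sum y' w) - G i (case_sum y w)))
      = (\<Sum>i\<in>I. (case i of (j, \<alpha>) \<Rightarrow> v j * z \<alpha>) *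
          (\<Sum>\<beta><n. partial (G i) (Inl \<beta>) (case_sum y0 w) * (y' \<beta> - y \<beta>)))"
    by (rule mean_value_first_argument[where I = I and G = G and c = "\<lambda>(j, \<alpha>). v j * z \<alpha>", OF diff y w])
  define H where "H = (\<lambda>j (\<alpha>, \<beta>). hess f (case_sum y0 w) j (c \<alpha>) (Inl \<beta>))"
  have H: "partial (G (j, \<alpha>)) (Inl \<beta>) (case_sum y0 w) = H j (\<alpha>, \<beta>)" for j \<alpha> \<beta>
    by (simp add: G_def H_def hess_def)
  have "L2_set z {..<q} * L2_set z {..<q} = (\<Sum>\<alpha><q. z \<alpha> * z \<alpha>)"
    by (simp add: L2_set_power2 flip: power2_eq_square)
  also have "\<dots> = (\<Sum>\<alpha><q. \<Sum>j<p. v j * z \<alpha> * (G (j, \<alpha>) (case_sum y' w) - G (j, \<alpha>) (case_sum y w)))"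
    unfolding G_def prod.case
    by (subst (2) z_def) (simp add: sum_distrib_left mult_ac)
  also have "\<dots> = (\<Sum>j<p. \<Sum>\<alpha><q. v j * z \<alpha> * (G (j, \<alpha>) (case_sum y' w) - G (j, \<alpha>) (case_sum y w)))"
    by (rule sum.swap)
  also have "\<dots> = (\<Sum>i\<in>I. (case i of (j, \<alpha>) \<Rightarrow> v j * z \<alpha>) * (G i (case_sum y' w) - G i (case_sum y w)))"
    unfolding I_def sum.cartesian_product by (intro sum.cong) auto
  also have "\<dots> = (\<Sum>(j, \<alpha>)\<in>I. v j * z \<alpha> * (\<Sum>\<beta><n. H j (\<alpha>, \<beta>) * h \<beta>))"
    unfolding y0(2) h_def by (intro sum.cong) (auto simp: H)
  also have "\<dots> = (\<Sum>j<p. v j * (\<Sum>\<alpha><q. \<Sum>\<beta><n. H j (\<alpha>, \<beta>) * (z \<alpha> * h \<beta>)))"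
    unfolding I_def sum.cartesian_product[symmetric] by (simp add: sum_distrib_left mult_ac)
  also have "\<dots> = (\<Sum>j<p. v j * (\<Sum>i\<in>{..<q} \<times> {..<n}. H j i * (case i of (\<alpha>, \<beta>) \<Rightarrow> z \<alpha> * h \<beta>)))"
    unfolding sum.cartesian_product by (simp add: case_prod_unfold)
  also have "\<dots> \<le> L2_set v {..<p} *
      L2_set (\<lambda>j. \<Sum>i\<in>{..<q} \<times> {..<n}. H j i * (case i of (\<alpha>, \<beta>) \<Rightarrow> z \<alpha> * h \<beta>)) {..<p}"
    by (rule order_trans[OF abs_ge_self abs_sum_mult_le_L2_set])
  also have "\<dots> \<le> L2_set v {..<p} * (C * L2_set (\<lambda>(\<alpha>, \<beta>). z \<alpha> * h \<beta>) ({..<q} \<times> {..<n}))"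
    unfolding H_def
    by (rule mult_left_mono[OF L2_set_mult_le[OF _ bound[OF y0(1)]] L2_set_nonneg]) simp
  finally have *: "L2_set z {..<q} * L2_set z {..<q} \<le> (C * L2_set v {..<p} * L2_set h {..<n}) * L2_set z {..<q}"
    unfolding L2_set_Times by (simp add: mult_ac)
  show ?thesis
    using self_bound_cancel[OF *] C unfolding z_def h_def by simp
qed

subsection \<open>Error propagation through the network\<close>

lemma backward_recursion_bound:
  fixes b c :: "nat \<Rightarrow> real"
  assumes "b N \<le> 0" "\<And>l. 1 \<le> l \<Longrightarrow> l < N \<Longrightarrow> b l \<le> q * b (Suc l) + c l" "0 \<le> q"
    and "1 \<le> l" "l \<le> N"
  shows "b l \<le> (\<Sum>i=l..<N. q ^ (i - l) * c i)"
  using assms(5,4)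
proof (induction rule: inc_induct)
  case base
  then show ?case using assms(1) by simp
next
  case (step l)
  have "b l \<le> q * b (Suc l) + c l"
    using step assms(2) by simp
  also have "q * b (Suc l) \<le> q * (\<Sum>i=Suc l..<N. q ^ (i - Suc l) * c i)"
    using step assms(3) by (intro mult_left_mono) auto
  also have "\<dots> = (\<Sum>i=Suc l..<N. q ^ (i - l) * c i)"
    unfolding sum_distrib_left
    by (intro sum.cong) (auto simp: Suc_diff_Suc simp flip: power_Suc mult.assoc)
  finally show ?case
    using step by (simp add: sum.atLeast_Suc_lessThan)
qed

lemma forward_recursion_bound:
  fixes b c :: "nat \<Rightarrow> real"
  assumes "b 0 \<le> 0" "\<And>j. j < n \<Longrightarrow> b (Suc j) \<le> q * b j + c (Suc j)" "0 \<le> q" and "j \<le> n"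
  shows "b j \<le> (\<Sum>i=1..j. q ^ (j - i) * c i)"
  using assms(4)
proof (induction j)
  case 0
  then show ?case using assms(1) by simp
next
  case (Suc j)
  have "b (Suc j) \<le> q * b j + c (Suc j)"
    using Suc assms(2) by simp
  also have "q * b j \<le> q * (\<Sum>i=1..j. q ^ (j - i) * c i)"
    using Suc assms(3) by (intro mult_left_mono) auto
  also have "\<dots> = (\<Sum>i=1..j. q ^ (Suc j - i) * c i)"
    unfolding sum_distrib_left
    by (intro sum.cong) (auto simp: Suc_diff_le)
  finally show ?case by simp
qed

text \<open>A source \<open>c i\<close> reaches each layer l <= i after i - l steps; the extra
  factor \<open>q\<close> is the passage from a backward vector to the gradient of its layer.
  Exchanging the sums collects, for each source, the exponents i + 1 - l, which run through 1, ...,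
  i.\<close>

lemma backward_recursion_sum_bound:
  fixes b c :: "nat \<Rightarrow> real"
  assumes "b N \<le> 0" "\<And>l. 1 \<le> l \<Longrightarrow> l < N \<Longrightarrow> b l \<le> q * b (Suc l) + c l" "0 \<le> q"
  shows "(\<Sum>l=1..N. q * b l) \<le> (\<Sum>i=1..<N. (\<Sum>k=1..i. q ^ k) * c i)"
proof -
  have "(\<Sum>l=1..N. q * b l) \<le> (\<Sum>l=1..N. q * (\<Sum>i=l..<N. q ^ (i - l) * c i))"
    using assms by (intro sum_mono mult_left_mono backward_recursion_bound) auto
  also have "\<dots> = (\<Sum>l=1..N. \<Sum>i | i \<in> {1..<N} \<and> l \<le> i. q ^ (i + 1 - l) * c i)"
    unfolding sum_distrib_left
    by (intro sum.cong) (auto simp: Suc_diff_le)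
  also have "\<dots> = (\<Sum>i=1..<N. \<Sum>l | l \<in> {1..N} \<and> l \<le> i. q ^ (i + 1 - l) * c i)"
    by (rule sum.swap_restrict) auto
  also have "\<dots> = (\<Sum>i=1..<N. (\<Sum>l=1..i. q ^ (i + 1 - l)) * c i)"
    unfolding sum_distrib_right by (intro sum.cong) auto
  also have "\<dots> = (\<Sum>i=1..<N. (\<Sum>k=1..i. q ^ k) * c i)"
    by (subst sum.atLeastAtMost_rev) simp
  finally show ?thesis .
qed

text \<open>Layers are written \<open>Suc i\<close>, so that \<open>i\<close> indexes the layer
  input. The bound on \<open>hess11\<close> begins at \<open>0 < i\<close>: gradients use backward
  vectors down to layer 1 only, and these involve input Jacobians of layers 2 to N.\<close>

locale regular_network =
  fixes N :: nat and d dw :: "nat \<Rightarrow> nat" and f :: "nat \<Rightarrow> layer_map" and C1 C2 :: real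
  assumes N: "1 \<le> N" and d_N: "d N = 1" and C1: "0 \<le> C1" and C2: "0 \<le> C2"
    and twice_diff: "i < N \<Longrightarrow> twice_diff_operator (d i) (dw (Suc i)) (d (Suc i)) (f (Suc i))"
    and jac1_bound: "i < N \<Longrightarrow> y \<in> vecs {..<d i} \<Longrightarrow> v \<in> vecs {..<dw (Suc i)} \<Longrightarrow>
      op_norm {..<d (Suc i)} {..<d i} (jac1 (f (Suc i)) y v) \<le> C1"
    and jac2_bound: "i < N \<Longrightarrow> y \<in> vecs {..<d i} \<Longrightarrow> v \<in> vecs {..<dw (Suc i)} \<Longrightarrow>
      op_norm {..<d (Suc i)} {..<dw (Suc i)} (jac2 (f (Suc i)) y v) \<le> C1"
    and hess11_bound: "0 < i \<Longrightarrow> i < N \<Longrightarrow> y \<in> vecs {..<d i} \<Longrightarrow> v \<in> vecs {..<dw (Suc i)} \<Longrightarrow>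
      op_norm {..<d (Suc i)} ({..<d i} \<times> {..<d i}) (hess11 (f (Suc i)) y v) \<le> C2"
    and hess21_bound: "i < N \<Longrightarrow> y \<in> vecs {..<d i} \<Longrightarrow> v \<in> vecs {..<dw (Suc i)} \<Longrightarrow>
      op_norm {..<d (Suc i)} ({..<dw (Suc i)} \<times> {..<d i}) (hess21 (f (Suc i)) y v) \<le> C2"
begin

abbreviation layer_jac1 :: "(nat \<times> nat \<Rightarrow> real) \<Rightarrow> (nat \<Rightarrow> rvec) \<Rightarrow> nat \<Rightarrow> nat \<Rightarrow> nat \<Rightarrow> real" where
  "layer_jac1 W Y i \<equiv> jac1 (f (Suc i)) (Y i) (layer_weight W (Suc i))"

abbreviation layer_jac2 :: "(nat \<times> nat \<Rightarrow> real) \<Rightarrow> (nat \<Rightarrow> rvec) \<Rightarrow> nat \<Rightarrow> nat \<Rightarrow> nat \<Rightarrow> real" where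
  "layer_jac2 W Y i \<equiv> jac2 (f (Suc i)) (Y i) (layer_weight W (Suc i))"

lemma layer_weight_vecs:
  "W \<in> vecs (weight_index N dw) \<Longrightarrow> layer_weight W i \<in> vecs {..<dw i}"
  by (auto simp: vecs_def weight_index_def layer_weight_def)

lemma forward_vecs:
  assumes W: "W \<in> vecs (weight_index N dw)" and X: "X \<in> vecs {..<d 0}"
    and D: "\<And>i. 1 \<le> i \<Longrightarrow> i \<le> N \<Longrightarrow> D i \<in> vecs {..<d i}"
    and "i \<le> N"
  shows "forward f W X D i \<in> vecs {..<d i}"
  using \<open>i \<le> N\<close>
proof (induction i)
  case 0
  then show ?case using X by simp
next
  case (Suc i)
  have "f (Suc i) (forward f W X D i) (layer_weight W (Suc i)) \<in> vecs {..<d (Suc i)}"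
    using Suc twice_diff[of i] layer_weight_vecs[OF W] by (auto simp: twice_diff_operator_def)
  then show ?case
    using Suc D[of "Suc i"] by (simp add: vecs_def)
qed

lemma forward_error_step:
  assumes W: "W \<in> vecs (weight_index N dw)"
    and y: "y \<in> vecs {..<d i}" "y' \<in> vecs {..<d i}" and i: "i < N"
  shows "(L2_set (\<lambda>k. f (Suc i) y' (layer_weight W (Suc i)) k + e k - f (Suc i) y (layer_weight W (Suc i)) k)
      {..<d (Suc i)})\<^sup>2 \<le> 2 * C1\<^sup>2 * (L2_set (\<lambda>k. y' k - y k) {..<d i})\<^sup>2 + 2 * (L2_set e {..<d (Suc i)})\<^sup>2"
    (is "(L2_set ?E _)\<^sup>2 \<le> _")
proof -
  define v where "v = layer_weight W (Suc i)"
  have v: "v \<in> vecs {..<dw (Suc i)}"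
    unfolding v_def by (rule layer_weight_vecs[OF W])
  have eq: "f (Suc i) y' v k + e k - f (Suc i) y v k = (f (Suc i) y' v k - f (Suc i) y v k) + e k" for k
    by simp
  have "L2_set ?E {..<d (Suc i)}
      \<le> L2_set (\<lambda>k. f (Suc i) y' v k - f (Suc i) y v k) {..<d (Suc i)} + L2_set e {..<d (Suc i)}"
    unfolding v_def[symmetric] eq by (rule L2_set_triangle_ineq)
  also have "\<dots> \<le> C1 * L2_set (\<lambda>k. y' k - y k) {..<d i} + L2_set e {..<d (Suc i)}"
    using twice_diff_operator_lipschitz[OF twice_diff[OF i] jac1_bound[OF i _ v] C1 y v] by simp
  finally have "(L2_set ?E {..<d (Suc i)})\<^sup>2
      \<le> (C1 * L2_set (\<lambda>k. y' k - y k) {..<d i} + L2_set e {..<d (Suc i)})\<^sup>2"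
    by (intro power_mono L2_set_nonneg)
  also have "\<dots> \<le> 2 * (C1 * L2_set (\<lambda>k. y' k - y k) {..<d i})\<^sup>2 + 2 * (L2_set e {..<d (Suc i)})\<^sup>2"
    by (rule power2_add_le)
  finally show ?thesis
    by (simp add: power_mult_distrib)
qed

text \<open>Both passes start from the same sample, so the recursion starts at 0. \<open>D i\<close>
  enters at the output of layer i with the factor 2 of the split and is multiplied by 2 C1^2 in each
  of the j - i later layers.\<close>

lemma forward_error_bound:
  assumes W: "W \<in> vecs (weight_index N dw)" and X: "X \<in> vecs {..<d 0}"
    and D: "\<And>i. 1 \<le> i \<Longrightarrow> i \<le> N \<Longrightarrow> D i \<in> vecs {..<d i}"
    and j: "j \<le> N"
  shows "(L2_set (\<lambda>k. forward f W X D j k - forward f W X (\<lambda>_ _. 0) j k) {..<d j})\<^sup>2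
    \<le> 2 * (\<Sum>i=1..j. (2 * C1\<^sup>2) ^ (j - i) * (L2_set (D i) {..<d i})\<^sup>2)"
proof -
  define b where "b j = (L2_set (\<lambda>k. forward f W X D j k - forward f W X (\<lambda>_ _. 0) j k) {..<d j})\<^sup>2" for j
  have z: "(\<lambda>_. 0) \<in> vecs {..<d i}" for i
    by (simp add: vecs_def)
  have "b j \<le> (\<Sum>i=1..j. (2 * C1\<^sup>2) ^ (j - i) * (2 * (L2_set (D i) {..<d i})\<^sup>2))"
  proof (rule forward_recursion_bound[OF _ _ _ j])
    show "b 0 \<le> 0"
      by (simp add: b_def L2_set_0')
    show "b (Suc i) \<le> 2 * C1\<^sup>2 * b i + 2 * (L2_set (D (Suc i)) {..<d (Suc i)})\<^sup>2" if "i < N" for i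
    proof -
      have "forward f W X (\<lambda>_ _. 0) i \<in> vecs {..<d i}" "forward f W X D i \<in> vecs {..<d i}"
        using that by (auto intro!: forward_vecs W X z D)
      from forward_error_step[OF W this that, of "D (Suc i)"] show ?thesis
        by (simp add: b_def)
    qed
  qed simp
  then show ?thesis
    by (simp add: b_def sum_distrib_left mult_ac)
qed

lemma backward_step:
  "i < N \<Longrightarrow> k < d i \<Longrightarrow> backward N d f W Y E i k
     = (\<Sum>j<d (Suc i). layer_jac1 W Y i j k * backward N d f W Y E (Suc i) j) + E (Suc i) k"
  by (subst backward.simps) simp

lemma backward_last: "backward N d f W Y E N = (\<lambda>k. if k = 0 then 1 else 0)"
  by (subst backward.simps) simp

lemma backward_norm:
  assumes W: "W \<in> vecs (weight_index N dw)"
    and Y: "\<And>i. 1 \<le> i \<Longrightarrow> i < N \<Longrightarrow> Y i \<in> vecs {..<d i}"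
    and i: "1 \<le> i" "i \<le> N"
  shows "L2_set (backward N d f W Y (\<lambda>_ _. 0) i) {..<d i} \<le> Cv N C1"
proof -
  have "L2_set (backward N d f W Y (\<lambda>_ _. 0) i) {..<d i} \<le> C1 ^ (N - i)"
    using i(2,1)
  proof (induction rule: inc_induct)
    case base
    then show ?case by (simp add: backward_last d_N L2_set_def)
  next
    case (step i)
    have "L2_set (backward N d f W Y (\<lambda>_ _. 0) i) {..<d i} =
        L2_set (\<lambda>k. \<Sum>j<d (Suc i). layer_jac1 W Y i j k * backward N d f W Y (\<lambda>_ _. 0) (Suc i) j) {..<d i}"
      using step by (intro L2_set_cong refl) (simp add: backward_step)
    also have "\<dots> \<le> C1 * L2_set (backward N d f W Y (\<lambda>_ _. 0) (Suc i)) {..<d (Suc i)}"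
      using step by (intro L2_set_transpose_mult_le jac1_bound Y layer_weight_vecs[OF W] C1) auto
    also have "\<dots> \<le> C1 * C1 ^ (N - Suc i)"
      using step by (intro mult_left_mono C1) auto
    also have "\<dots> = C1 ^ (N - i)"
      using step by (simp add: Suc_diff_Suc flip: power_Suc)
    finally show ?case .
  qed
  also have "\<dots> \<le> Cv N C1"
  \<comment> \<open>Powers of \<open>C1\<close> are at most 1 when \<open>C1 \<le> 1\<close> and
    increase with the exponent otherwise; this is the origin of the maximum in
    \<open>Cv\<close>.\<close>
  proof (cases "C1 \<le> 1")
    case True
    then show ?thesis
      using power_le_one[OF C1 True, of "N - i"] by (simp add: Cv_def)
  next
    case False
    then have "C1 ^ (N - i) \<le> C1 ^ N"
      by (intro power_increasing) auto
    then show ?thesis by (simp add: Cv_def)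
  qed
  finally show ?thesis .
qed

text \<open>
  The Jacobian at the perturbed point acts on the error of the later layers, the difference of
  Jacobians on the unperturbed vector, which is bounded by \<^const>\<open>Cv\<close>.
\<close>

lemma transpose_error_step:
  assumes "finite K" "finite I"
    and A': "op_norm I K A' \<le> C1"
    and diff: "L2_set (\<lambda>k. \<Sum>j\<in>I. (A' j k - A j k) * v j) K \<le> C2 * L2_set v I * e"
    and v: "L2_set v I \<le> Cv N C1" and e: "0 \<le> e"
  shows "(L2_set (\<lambda>k. (\<Sum>j\<in>I. A' j k * v' j) - (\<Sum>j\<in>I. A j k * v j)) K)\<^sup>2
    \<le> 2 * C1\<^sup>2 * (L2_set (\<lambda>j. v' j - v j) I)\<^sup>2 + 2 * C2\<^sup>2 * (Cv N C1)\<^sup>2 * e\<^sup>2"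
    (is "(L2_set ?E K)\<^sup>2 \<le> _")
proof -
  have eq: "(\<Sum>j\<in>I. A' j k * v' j) - (\<Sum>j\<in>I. A j k * v j)
      = (\<Sum>j\<in>I. A' j k * (v' j - v j)) + (\<Sum>j\<in>I. (A' j k - A j k) * v j)" for k
    by (simp add: algebra_simps sum_subtractf flip: sum.distrib)
  have "L2_set ?E K \<le> L2_set (\<lambda>k. \<Sum>j\<in>I. A' j k * (v' j - v j)) K + L2_set (\<lambda>k. \<Sum>j\<in>I. (A' j k - A j k) * v j) K"
    unfolding eq by (rule L2_set_triangle_ineq)
  also have "\<dots> \<le> C1 * L2_set (\<lambda>j. v' j - v j) I + C2 * Cv N C1 * e"
  proof (rule add_mono)
    show "L2_set (\<lambda>k. \<Sum>j\<in>I. A' j k * (v' j - v j)) K \<le> C1 * L2_set (\<lambda>j. v' j - v j) I"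
      using assms C1 by (intro L2_set_transpose_mult_le)
    have "C2 * L2_set v I * e \<le> C2 * Cv N C1 * e"
      using v e C2 by (intro mult_right_mono mult_left_mono)
    then show "L2_set (\<lambda>k. \<Sum>j\<in>I. (A' j k - A j k) * v j) K \<le> C2 * Cv N C1 * e"
      using diff by linarith
  qed
  finally have "(L2_set ?E K)\<^sup>2 \<le> (C1 * L2_set (\<lambda>j. v' j - v j) I + C2 * Cv N C1 * e)\<^sup>2"
    by (intro power_mono L2_set_nonneg)
  also have "\<dots> \<le> 2 * (C1 * L2_set (\<lambda>j. v' j - v j) I)\<^sup>2 + 2 * (C2 * Cv N C1 * e)\<^sup>2"
    by (rule power2_add_le)
  finally show ?thesis
    by (simp add: power_mult_distrib)
qed

text \<open>Here the bound on \<open>hess11\<close> enters: the Jacobian in the layer input varies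
  with that same input at rate \<open>C2\<close>.\<close>

lemma layer_jac1_difference:
  assumes W: "W \<in> vecs (weight_index N dw)"
    and Y: "Y i \<in> vecs {..<d i}" "Y' i \<in> vecs {..<d i}" and i: "0 < i" "i < N"
  shows "L2_set (\<lambda>k. \<Sum>j<d (Suc i). (layer_jac1 W Y' i j k - layer_jac1 W Y i j k) * v j) {..<d i}
    \<le> C2 * L2_set v {..<d (Suc i)} * L2_set (\<lambda>k. Y' i k - Y i k) {..<d i}"
  unfolding jac1_def
  using i hess11_bound[OF i _ layer_weight_vecs[OF W]]
  by (intro jac_transpose_difference[OF twice_diff] Y C2 layer_weight_vecs W)
    (auto simp: hess11_def[abs_def])

lemma layer_jac2_difference:
  assumes W: "W \<in> vecs (weight_index N dw)"
    and Y: "Y i \<in> vecs {..<d i}" "Y' i \<in> vecs {..<d i}" and i: "i < N"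
  shows "L2_set (\<lambda>k. \<Sum>j<d (Suc i). (layer_jac2 W Y' i j k - layer_jac2 W Y i j k) * v j) {..<dw (Suc i)}
    \<le> C2 * L2_set v {..<d (Suc i)} * L2_set (\<lambda>k. Y' i k - Y i k) {..<d i}"
  unfolding jac2_def
  using i hess21_bound[OF i _ layer_weight_vecs[OF W]]
  by (intro jac_transpose_difference[OF twice_diff] Y C2 layer_weight_vecs W)
    (auto simp: hess21_def[abs_def])

lemma sum_weight_index:
  "(\<Sum>p\<in>weight_index N dw. h p) = (\<Sum>i<N. \<Sum>k<dw (Suc i). h (Suc i, k))"
proof -
  have "(\<Sum>p\<in>weight_index N dw. h p) = (\<Sum>i=1..N. \<Sum>k<dw i. h (i, k))"
    unfolding weight_index_def by (simp add: sum.Sigma)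
  also have "\<dots> = (\<Sum>i<N. \<Sum>k<dw (Suc i). h (Suc i, k))"
    by (simp add: sum.shift_bounds_cl_Suc_ivl lessThan_atLeast0 sum.atLeast1_atMost_eq)
  finally show ?thesis .
qed

end

section \<open>Summation of the layer errors over the stacked gradient\<close>

context regular_network
begin

lemma stacked_grad_Suc:
  "stacked_grad N d f W X D E (Suc i, k) =
    (\<Sum>j<d (Suc i). layer_jac2 W (forward f W X D) i j k * backward N d f W (forward f W X D) E (Suc i) j)"
  by (simp add: stacked_grad_def)

text \<open>The factor 2 on the left belongs to the split at the intermediate gradient. The squared
  errors \<open>b\<close> of the backward vectors obey a downward recursion. Its source
  \<open>c j\<close> bounds the effect of the Jacobian difference at layer j + 1, caused by the
  displaced input \<open>Y' j\<close>, and this displacement is controlled by the forward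
  recursion.\<close>

lemma forward_perturbation_grad_bound:
  assumes W: "W \<in> vecs (weight_index N dw)" and X: "X \<in> vecs {..<d 0}"
    and D: "\<And>i. 1 \<le> i \<Longrightarrow> i \<le> N \<Longrightarrow> D i \<in> vecs {..<d i}"
  shows "2 * (\<Sum>p\<in>weight_index N dw.
      (stacked_grad N d f W X D (\<lambda>_ _. 0) p - stacked_grad N d f W X (\<lambda>_ _. 0) (\<lambda>_ _. 0) p)\<^sup>2)
    \<le> (\<Sum>i=1..N - 1. Cb_delta N C1 C2 i * (L2_set (D i) {..<d i})\<^sup>2)"
proof -
  define Y where "Y = forward f W X (\<lambda>_ _. 0)"
  define Y' where "Y' = forward f W X D"
  define v where "v = backward N d f W Y (\<lambda>_ _. 0)"
  define v' where "v' = backward N d f W Y' (\<lambda>_ _. 0)"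
  define b where "b l = (L2_set (\<lambda>k. v' l k - v l k) {..<d l})\<^sup>2" for l
  define n where "n i = (L2_set (D i) {..<d i})\<^sup>2" for i
  define q where "q = 2 * C1\<^sup>2"
  define A where "A = 2 * C2\<^sup>2 * (Cv N C1)\<^sup>2"
  define c where "c j = A * (L2_set (\<lambda>k. Y' j k - Y j k) {..<d j})\<^sup>2" for j
  have q: "0 \<le> q" and A: "0 \<le> A"
    by (simp_all add: q_def A_def)
  have Y: "Y i \<in> vecs {..<d i}" if "i \<le> N" for i
    unfolding Y_def using that by (intro forward_vecs W X) (auto simp: vecs_def)
  have Y': "Y' i \<in> vecs {..<d i}" if "i \<le> N" for i
    unfolding Y'_def using that by (intro forward_vecs W X D)
  have v: "L2_set (v i) {..<d i} \<le> Cv N C1" if "1 \<le> i" "i \<le> N" for i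
    unfolding v_def using that by (intro backward_norm W Y) auto
  have b_step: "b l \<le> q * b (Suc l) + c l" if l: "1 \<le> l" "l < N" for l
  proof -
    have "b l = (L2_set (\<lambda>k. (\<Sum>j<d (Suc l). layer_jac1 W Y' l j k * v' (Suc l) j)
        - (\<Sum>j<d (Suc l). layer_jac1 W Y l j k * v (Suc l) j)) {..<d l})\<^sup>2"
      unfolding b_def v_def v'_def using l
      by (intro arg_cong[where f = "\<lambda>x. x\<^sup>2"] L2_set_cong refl) (simp add: backward_step)
    also have "\<dots> \<le> q * b (Suc l) + c l"
      unfolding q_def b_def c_def A_def using l
      by (intro transpose_error_step layer_jac1_difference jac1_bound W Y Y' v layer_weight_vecs) auto
    finally show ?thesis .
  qed
  have b_N: "b N \<le> 0"
    by (simp add: b_def v_def v'_def backward_last L2_set_0')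
  have layer: "(\<Sum>k<dw (Suc i). (stacked_grad N d f W X D (\<lambda>_ _. 0) (Suc i, k)
      - stacked_grad N d f W X (\<lambda>_ _. 0) (\<lambda>_ _. 0) (Suc i, k))\<^sup>2) \<le> q * b (Suc i) + c i"
    if i: "i < N" for i
  proof -
    have "(L2_set (\<lambda>k. (\<Sum>j<d (Suc i). layer_jac2 W Y' i j k * v' (Suc i) j)
        - (\<Sum>j<d (Suc i). layer_jac2 W Y i j k * v (Suc i) j)) {..<dw (Suc i)})\<^sup>2 \<le> q * b (Suc i) + c i"
      unfolding q_def b_def c_def A_def using i
      by (intro transpose_error_step layer_jac2_difference jac2_bound W Y Y' v layer_weight_vecs) auto
    then show ?thesis
      by (simp only: stacked_grad_Suc L2_set_power2 Y_def Y'_def v_def v'_def)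
  qed
  \<comment> \<open>Layer 1 receives the sample itself in both passes, so the sources start at index
    1.\<close>
  have "c 0 = 0"
    by (simp add: c_def Y_def Y'_def L2_set_0')
  have "(\<Sum>p\<in>weight_index N dw.
      (stacked_grad N d f W X D (\<lambda>_ _. 0) p - stacked_grad N d f W X (\<lambda>_ _. 0) (\<lambda>_ _. 0) p)\<^sup>2)
      \<le> (\<Sum>i<N. q * b (Suc i) + c i)"
    unfolding sum_weight_index by (intro sum_mono layer) simp
  also have "\<dots> = (\<Sum>l=1..N. q * b l) + (\<Sum>i<N. c i)"
    by (simp add: sum.distrib lessThan_atLeast0 sum.atLeast1_atMost_eq)
  also have "(\<Sum>i<N. c i) = (\<Sum>i=1..<N. c i)"
    using N \<open>c 0 = 0\<close> by (simp add: lessThan_atLeast0 sum.atLeast_Suc_lessThan)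
  also have "(\<Sum>l=1..N. q * b l) \<le> (\<Sum>i=1..<N. (\<Sum>k=1..i. q ^ k) * c i)"
    by (rule backward_recursion_sum_bound[OF b_N b_step q])
  \<comment> \<open>The term k = 0 is the direct change of the weight Jacobian; the terms k >= 1
    arrive through the backward vectors.\<close>
  also have "(\<Sum>i=1..<N. (\<Sum>k=1..i. q ^ k) * c i) + (\<Sum>i=1..<N. c i)
      = (\<Sum>i=1..<N. (\<Sum>k=0..i. q ^ k) * c i)"
    by (simp add: sum.atLeast_Suc_atMost algebra_simps flip: sum.distrib)
  also have "\<dots> \<le> (\<Sum>j=1..<N. (\<Sum>k=0..j. q ^ k) * (A * (2 * (\<Sum>i=1..j. q ^ (j - i) * n i))))"
    unfolding c_def Y_def Y'_def q_def n_def
    by (intro sum_mono mult_left_mono forward_error_bound W X D A sum_nonneg) auto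
  also have "\<dots> = (\<Sum>j=1..<N. \<Sum>i | i \<in> {1..<N} \<and> i \<le> j. (\<Sum>k=0..j. q ^ k) * (A * (2 * (q ^ (j - i) * n i))))"
    unfolding sum_distrib_left by (intro sum.cong) auto
  \<comment> \<open>\<open>D i\<close> displaces only outputs of layers j >= i, so after the
    exchange its coefficient is a sum over j from i to N - 1.\<close>
  also have "\<dots> = (\<Sum>i=1..<N. \<Sum>j | j \<in> {1..<N} \<and> i \<le> j. (\<Sum>k=0..j. q ^ k) * (A * (2 * (q ^ (j - i) * n i))))"
    by (rule sum.swap_restrict) auto
  also have "\<dots> = (\<Sum>i=1..N - 1. 2 * A * (\<Sum>j=i..N - 1. (\<Sum>k=0..j. q ^ k) * q ^ (j - i)) * n i)"
    unfolding sum_distrib_left sum_distrib_right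
    by (intro sum.cong) (auto simp: mult_ac)
  \<comment> \<open>The ratio 2 C1^2 is enlarged here to the two ratios occurring in
    \<open>Cb_delta\<close>; all terms are nonnegative.\<close>
  also have "\<dots> \<le> (\<Sum>i=1..N - 1. 2 * A *
      (\<Sum>j=i..N - 1. (\<Sum>k=0..j. (3 * C1\<^sup>2) ^ k) * (4 * C1\<^sup>2) ^ (j - i)) * n i)"
    using A unfolding q_def
    by (intro sum_mono mult_right_mono mult_left_mono mult_mono power_mono)
      (auto simp: n_def intro!: sum_nonneg)
  finally have "2 * (\<Sum>p\<in>weight_index N dw.
      (stacked_grad N d f W X D (\<lambda>_ _. 0) p - stacked_grad N d f W X (\<lambda>_ _. 0) (\<lambda>_ _. 0) p)\<^sup>2)
    \<le> 2 * (\<Sum>i=1..N - 1. 2 * A *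
      (\<Sum>j=i..N - 1. (\<Sum>k=0..j. (3 * C1\<^sup>2) ^ k) * (4 * C1\<^sup>2) ^ (j - i)) * n i)"
    by simp
  \<comment> \<open>The prefactor is 2 * 2 * \<open>A\<close> = 8 C2^2 Cv^2.\<close>
  also have "\<dots> = (\<Sum>i=1..N - 1. Cb_delta N C1 C2 i * n i)"
    unfolding sum_distrib_left[of 2] by (intro sum.cong) (simp_all add: Cb_delta_def A_def mult_ac)
  finally show ?thesis
    unfolding n_def .
qed

text \<open>The vectors \<open>m\<close>, \<open>e\<close> and \<open>g\<close> are abstract because
  they will be values, at a fixed sample point, of conditional expectations: of the backward error,
  of the backward perturbation, and of the resulting gradient error. Only the linear recursion
  between them matters.\<close>

lemma backward_perturbation_grad_bound:
  assumes W: "W \<in> vecs (weight_index N dw)"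
    and Y: "\<And>i. i < N \<Longrightarrow> Y i \<in> vecs {..<d i}"
    and m_N: "\<And>k. k < d N \<Longrightarrow> m N k = 0"
    and m: "\<And>l k. 1 \<le> l \<Longrightarrow> l < N \<Longrightarrow> k < d l \<Longrightarrow>
      m l k = (\<Sum>j<d (Suc l). layer_jac1 W Y l j k * m (Suc l) j) + e (Suc l) k"
    and g: "\<And>i k. i < N \<Longrightarrow> k < dw (Suc i) \<Longrightarrow>
      g (Suc i, k) = (\<Sum>j<d (Suc i). layer_jac2 W Y i j k * m (Suc i) j)"
  shows "2 * (\<Sum>p\<in>weight_index N dw. (g p)\<^sup>2)
    \<le> (\<Sum>i=1..N - 1. Cb_eps C1 (i + 1) * (L2_set (e (i + 1)) {..<d i})\<^sup>2)"
proof -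
  define b where "b l = (L2_set (m l) {..<d l})\<^sup>2" for l
  define n where "n i = (L2_set (e (Suc i)) {..<d i})\<^sup>2" for i
  define q where "q = 2 * C1\<^sup>2"
  have q: "0 \<le> q"
    by (simp add: q_def)
  have b_step: "b l \<le> q * b (Suc l) + 2 * n l" if l: "1 \<le> l" "l < N" for l
  proof -
    have "L2_set (m l) {..<d l}
        = L2_set (\<lambda>k. (\<Sum>j<d (Suc l). layer_jac1 W Y l j k * m (Suc l) j) + e (Suc l) k) {..<d l}"
      using l by (intro L2_set_cong refl) (simp add: m)
    also have "\<dots> \<le> L2_set (\<lambda>k. \<Sum>j<d (Suc l). layer_jac1 W Y l j k * m (Suc l) j) {..<d l}
        + L2_set (e (Suc l)) {..<d l}"
      by (rule L2_set_triangle_ineq)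
    also have "\<dots> \<le> C1 * L2_set (m (Suc l)) {..<d (Suc l)} + L2_set (e (Suc l)) {..<d l}"
      using l by (intro add_right_mono L2_set_transpose_mult_le jac1_bound Y layer_weight_vecs W C1) auto
    finally have "b l \<le> (C1 * L2_set (m (Suc l)) {..<d (Suc l)} + L2_set (e (Suc l)) {..<d l})\<^sup>2"
      unfolding b_def by (intro power_mono L2_set_nonneg)
    also have "\<dots> \<le> 2 * (C1 * L2_set (m (Suc l)) {..<d (Suc l)})\<^sup>2 + 2 * (L2_set (e (Suc l)) {..<d l})\<^sup>2"
      by (rule power2_add_le)
    finally show ?thesis
      by (simp add: b_def q_def n_def power_mult_distrib)
  qed
  have b_N: "b N \<le> 0"
    using m_N by (simp add: b_def L2_set_0')
  have layer: "2 * (\<Sum>k<dw (Suc i). (g (Suc i, k))\<^sup>2) \<le> q * b (Suc i)" if i: "i < N" for i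
  proof -
    have "(\<Sum>k<dw (Suc i). (g (Suc i, k))\<^sup>2)
        = (L2_set (\<lambda>k. \<Sum>j<d (Suc i). layer_jac2 W Y i j k * m (Suc i) j) {..<dw (Suc i)})\<^sup>2"
      unfolding L2_set_power2 using i by (intro sum.cong) (simp_all add: g)
    also have "\<dots> \<le> (C1 * L2_set (m (Suc i)) {..<d (Suc i)})\<^sup>2"
      using i by (intro power_mono L2_set_transpose_mult_le jac2_bound Y layer_weight_vecs W C1 L2_set_nonneg) auto
    finally show ?thesis
      by (simp add: b_def q_def power_mult_distrib)
  qed
  have "2 * (\<Sum>p\<in>weight_index N dw. (g p)\<^sup>2) \<le> (\<Sum>i<N. q * b (Suc i))"
    unfolding sum_weight_index sum_distrib_left[of 2] using layer
    by (intro sum_mono) (simp add: sum_distrib_left)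
  also have "\<dots> = (\<Sum>l=1..N. q * b l)"
    by (simp add: lessThan_atLeast0 sum.atLeast1_atMost_eq)
  also have "\<dots> \<le> (\<Sum>i=1..<N. (\<Sum>k=1..i. q ^ k) * (2 * n i))"
    by (rule backward_recursion_sum_bound[OF b_N b_step q])
  also have "\<dots> \<le> (\<Sum>i=1..<N. (\<Sum>k=1..i. (3 * C1\<^sup>2) ^ k) * (2 * n i))"
    unfolding q_def by (intro sum_mono mult_right_mono power_mono) (auto simp: n_def)
  also have "\<dots> = (\<Sum>i=1..N - 1. Cb_eps C1 (i + 1) * n i)"
    by (intro sum.cong) (auto simp: Cb_eps_def)
  finally show ?thesis
    by (simp add: n_def)
qed

end

subsection \<open>Conditional expectations and second moments\<close>

lemma integrable_bounded_mult:
  fixes a g :: "'a \<Rightarrow> real"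
  assumes "a \<in> borel_measurable M" "integrable M g" "\<And>\<omega>. \<omega> \<in> space M \<Longrightarrow> \<bar>a \<omega>\<bar> \<le> C"
  shows "integrable M (\<lambda>\<omega>. a \<omega> * g \<omega>)"
proof (rule Bochner_Integration.integrable_bound)
  show "integrable M (\<lambda>\<omega>. C * \<bar>g \<omega>\<bar>)"
    using assms by auto
  show "(\<lambda>\<omega>. a \<omega> * g \<omega>) \<in> borel_measurable M"
    using assms by (auto intro: borel_measurable_times)
  show "AE \<omega> in M. norm (a \<omega> * g \<omega>) \<le> norm (C * \<bar>g \<omega>\<bar>)"
    using assms(3) by (intro AE_I2) (force simp: abs_mult intro: mult_right_mono order_trans)
qed

lemma norm_moment_2:
  assumes "finite K" "\<And>k. k \<in> K \<Longrightarrow> (\<lambda>\<omega>. X \<omega> k) \<in> borel_measurable M"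
  shows "norm_moment M 2 K X = (\<Sum>k\<in>K. \<integral>\<^sup>+ \<omega>. ennreal ((X \<omega> k)\<^sup>2) \<partial>M)"
  using assms by (simp add: norm_moment_def L2_set_power2 nn_integral_sum flip: sum_ennreal)

lemma norm_moment_AE_cong:
  assumes "AE \<omega> in M. \<forall>k\<in>K. X \<omega> k = Y \<omega> k"
  shows "norm_moment M p K X = norm_moment M p K Y"
  unfolding norm_moment_def
proof (rule nn_integral_cong_AE)
  show "AE \<omega> in M. ennreal (L2_set (X \<omega>) K ^ p) = ennreal (L2_set (Y \<omega>) K ^ p)"
    using assms by eventually_elim (simp cong: L2_set_cong)
qed

text \<open>The decomposition is required almost everywhere only, since that is how conditional
  expectation is additive.\<close>

lemma norm_moment_2_add_le:
  assumes K: "finite K"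
    and Y: "\<And>k. k \<in> K \<Longrightarrow> (\<lambda>\<omega>. Y \<omega> k) \<in> borel_measurable M"
    and Z: "\<And>k. k \<in> K \<Longrightarrow> (\<lambda>\<omega>. Z \<omega> k) \<in> borel_measurable M"
    and eq: "AE \<omega> in M. \<forall>k\<in>K. X \<omega> k = Y \<omega> k + Z \<omega> k"
  shows "norm_moment M 2 K X \<le> 2 * norm_moment M 2 K Y + 2 * norm_moment M 2 K Z"
proof -
  have "norm_moment M 2 K X \<le> (\<integral>\<^sup>+ \<omega>. (\<Sum>k\<in>K. ennreal (2 * (Y \<omega> k)\<^sup>2 + 2 * (Z \<omega> k)\<^sup>2)) \<partial>M)"
    unfolding norm_moment_def L2_set_power2
  proof (rule nn_integral_mono_AE)
    show "AE \<omega> in M. ennreal (\<Sum>k\<in>K. (X \<omega> k)\<^sup>2) \<le> (\<Sum>k\<in>K. ennreal (2 * (Y \<omega> k)\<^sup>2 + 2 * (Z \<omega> k)\<^sup>2))"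
      using eq
    proof eventually_elim
      case (elim \<omega>)
      then have "ennreal (\<Sum>k\<in>K. (X \<omega> k)\<^sup>2) \<le> ennreal (\<Sum>k\<in>K. 2 * (Y \<omega> k)\<^sup>2 + 2 * (Z \<omega> k)\<^sup>2)"
        by (intro ennreal_leI sum_mono) (simp add: power2_add_le)
      also have "\<dots> = (\<Sum>k\<in>K. ennreal (2 * (Y \<omega> k)\<^sup>2 + 2 * (Z \<omega> k)\<^sup>2))"
        by (intro sum_ennreal[symmetric]) auto
      finally show ?case .
    qed
  qed
  also have "\<dots> = (\<Sum>k\<in>K. \<integral>\<^sup>+ \<omega>. 2 * ennreal ((Y \<omega> k)\<^sup>2) + 2 * ennreal ((Z \<omega> k)\<^sup>2) \<partial>M)"
    using Y Z by (subst nn_integral_sum) (auto simp: ennreal_mult)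
  also have "\<dots> = (\<Sum>k\<in>K. 2 * (\<integral>\<^sup>+ \<omega>. ennreal ((Y \<omega> k)\<^sup>2) \<partial>M) + 2 * (\<integral>\<^sup>+ \<omega>. ennreal ((Z \<omega> k)\<^sup>2) \<partial>M))"
    using Y Z by (intro sum.cong refl) (simp add: nn_integral_add nn_integral_cmult)
  finally show ?thesis
    using K Y Z by (simp add: norm_moment_2 sum.distrib sum_distrib_left)
qed

lemma norm_moment_2_le_sum:
  assumes "finite I" and c: "\<And>i. i \<in> I \<Longrightarrow> 0 \<le> c i"
    and A: "\<And>i k. i \<in> I \<Longrightarrow> k \<in> S i \<Longrightarrow> (\<lambda>\<omega>. A i \<omega> k) \<in> borel_measurable M"
    and bound: "AE \<omega> in M. 2 * (\<Sum>k\<in>K. (X \<omega> k)\<^sup>2) \<le> (\<Sum>i\<in>I. c i * (L2_set (A i \<omega>) (S i))\<^sup>2)"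
    and X: "\<And>k. k \<in> K \<Longrightarrow> (\<lambda>\<omega>. X \<omega> k) \<in> borel_measurable M"
  shows "2 * norm_moment M 2 K X \<le> (\<Sum>i\<in>I. ennreal (c i) * norm_moment M 2 (S i) (A i))"
proof -
  have L: "(\<lambda>\<omega>. ennreal ((L2_set (A i \<omega>) (S i))\<^sup>2)) \<in> borel_measurable M" if "i \<in> I" for i
    unfolding L2_set_power2 using A that by (intro measurable_compose[OF _ measurable_ennreal]) auto
  have "2 * norm_moment M 2 K X = (\<integral>\<^sup>+ \<omega>. 2 * ennreal (\<Sum>k\<in>K. (X \<omega> k)\<^sup>2) \<partial>M)"
    unfolding norm_moment_def L2_set_power2 using X
    by (intro nn_integral_cmult[symmetric] measurable_compose[OF _ measurable_ennreal]) auto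
  also have "\<dots> \<le> (\<integral>\<^sup>+ \<omega>. (\<Sum>i\<in>I. ennreal (c i) * ennreal ((L2_set (A i \<omega>) (S i))\<^sup>2)) \<partial>M)"
  proof (rule nn_integral_mono_AE)
    show "AE \<omega> in M. 2 * ennreal (\<Sum>k\<in>K. (X \<omega> k)\<^sup>2)
        \<le> (\<Sum>i\<in>I. ennreal (c i) * ennreal ((L2_set (A i \<omega>) (S i))\<^sup>2))"
      using bound
    proof eventually_elim
      case (elim \<omega>)
      have "2 * ennreal (\<Sum>k\<in>K. (X \<omega> k)\<^sup>2) = ennreal (2 * (\<Sum>k\<in>K. (X \<omega> k)\<^sup>2))"
        by (simp add: ennreal_mult sum_nonneg)
      also have "\<dots> \<le> ennreal (\<Sum>i\<in>I. c i * (L2_set (A i \<omega>) (S i))\<^sup>2)"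
        by (rule ennreal_leI[OF elim])
      also have "\<dots> = (\<Sum>i\<in>I. ennreal (c i * (L2_set (A i \<omega>) (S i))\<^sup>2))"
        using c by (intro sum_ennreal[symmetric]) auto
      also have "\<dots> = (\<Sum>i\<in>I. ennreal (c i) * ennreal ((L2_set (A i \<omega>) (S i))\<^sup>2))"
        using c by (intro sum.cong refl ennreal_mult) auto
      finally show ?case .
    qed
  qed
  also have "\<dots> = (\<Sum>i\<in>I. ennreal (c i) * norm_moment M 2 (S i) (A i))"
    unfolding norm_moment_def using L
    by (subst nn_integral_sum) (auto intro!: sum.cong nn_integral_cmult)
  finally show ?thesis .
qed

section \<open>Jensen, tower property, and linearity with measurable coefficients\<close>

context sigma_finite_subalgebra
begin

text \<open>Conditional Jensen for the square needs an integrable square. If the second moment is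
  infinite, the inequality in [0, infinity] is trivial, so integrability of \<open>X\<close>
  suffices.\<close>

lemma nn_integral_cond_exp_power2_le:
  assumes X: "integrable M X"
  shows "(\<integral>\<^sup>+ \<omega>. ennreal ((real_cond_exp M F X \<omega>)\<^sup>2) \<partial>M) \<le> (\<integral>\<^sup>+ \<omega>. ennreal ((X \<omega>)\<^sup>2) \<partial>M)"
proof (cases "(\<integral>\<^sup>+ \<omega>. ennreal ((X \<omega>)\<^sup>2) \<partial>M) = \<infinity>")
  case False
  have X2: "integrable M (\<lambda>\<omega>. (X \<omega>)\<^sup>2)"
    using X False by (intro integrableI_bounded) (auto simp: top.not_eq_extremum)
  have "convex_on UNIV (\<lambda>x :: real. x\<^sup>2)"
    by (rule convex_power2)
  then have "AE \<omega> in M. (real_cond_exp M F X \<omega>)\<^sup>2 \<le> real_cond_exp M F (\<lambda>\<omega>. (X \<omega>)\<^sup>2) \<omega>"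
    by (intro real_cond_exp_jensens_inequality(2)[where I = UNIV] X X2) auto
  then have "(\<integral>\<^sup>+ \<omega>. ennreal ((real_cond_exp M F X \<omega>)\<^sup>2) \<partial>M)
      \<le> (\<integral>\<^sup>+ \<omega>. ennreal (real_cond_exp M F (\<lambda>\<omega>. (X \<omega>)\<^sup>2) \<omega>) \<partial>M)"
    by (intro nn_integral_mono_AE) (auto intro: ennreal_leI)
  also have "\<dots> = ennreal (\<integral>\<omega>. real_cond_exp M F (\<lambda>\<omega>. (X \<omega>)\<^sup>2) \<omega> \<partial>M)"
    using X2 by (intro nn_integral_eq_integral real_cond_exp_int real_cond_exp_pos) auto
  also have "\<dots> = ennreal (\<integral>\<omega>. (X \<omega>)\<^sup>2 \<partial>M)"
    using X2 by (simp add: real_cond_exp_int)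
  also have "\<dots> = (\<integral>\<^sup>+ \<omega>. ennreal ((X \<omega>)\<^sup>2) \<partial>M)"
    using X2 by (intro nn_integral_eq_integral[symmetric]) auto
  finally show ?thesis .
qed simp

lemma norm_moment_cond_exp_le:
  assumes "finite K" "\<And>k. k \<in> K \<Longrightarrow> integrable M (\<lambda>\<omega>. X \<omega> k)"
  shows "norm_moment M 2 K (vec_cond_exp M F X) \<le> norm_moment M 2 K X"
  using assms
  by (auto simp: norm_moment_2 vec_cond_exp_def intro!: sum_mono nn_integral_cond_exp_power2_le)

text \<open>Conditioning on the smaller algebra factors through the larger one, and Jensen makes the
  outer step contract second moments.\<close>

lemma norm_moment_cond_exp_mono:
  assumes G: "subalgebra M G" "subalgebra G F"
    and K: "finite K" and X: "\<And>k. k \<in> K \<Longrightarrow> integrable M (\<lambda>\<omega>. X \<omega> k)"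
  shows "norm_moment M 2 K (vec_cond_exp M F X) \<le> norm_moment M 2 K (vec_cond_exp M G X)"
proof -
  interpret G: sigma_finite_subalgebra M G
    by (rule nested_subalg_is_sigma_finite[OF G])
  have "AE \<omega> in M. \<forall>k\<in>K. vec_cond_exp M F X \<omega> k = vec_cond_exp M F (vec_cond_exp M G X) \<omega> k"
    unfolding vec_cond_exp_def
    using X by (intro AE_finite_allI[OF K] AE_symmetric[OF real_cond_exp_nested_subalg[OF G]])
  then have "norm_moment M 2 K (vec_cond_exp M F X) = norm_moment M 2 K (vec_cond_exp M F (vec_cond_exp M G X))"
    by (rule norm_moment_AE_cong)
  also have "\<dots> \<le> norm_moment M 2 K (vec_cond_exp M G X)"
    using X by (intro norm_moment_cond_exp_le K) (auto simp: vec_cond_exp_def intro: G.real_cond_exp_int)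
  finally show ?thesis .
qed

text \<open>Bounded measurable coefficients can be pulled out of the conditional expectation when
  the factors are only integrable. The coefficients will be Jacobian entries.\<close>

lemma real_cond_exp_linear_combination:
  assumes J: "finite J"
    and a: "\<And>j. j \<in> J \<Longrightarrow> a j \<in> borel_measurable F"
    and bound: "\<And>j \<omega>. j \<in> J \<Longrightarrow> \<omega> \<in> space M \<Longrightarrow> \<bar>a j \<omega>\<bar> \<le> C"
    and X: "\<And>j. j \<in> J \<Longrightarrow> integrable M (X j)"
  shows "integrable M (\<lambda>\<omega>. \<Sum>j\<in>J. a j \<omega> * X j \<omega>)"
    and "AE \<omega> in M. real_cond_exp M F (\<lambda>\<omega>. \<Sum>j\<in>J. a j \<omega> * X j \<omega>) \<omega>
      = (\<Sum>j\<in>J. a j \<omega> * real_cond_exp M F (X j) \<omega>)"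
proof -
  have int: "integrable M (\<lambda>\<omega>. a j \<omega> * X j \<omega>)" if "j \<in> J" for j
    using that by (intro integrable_bounded_mult[where C = C] measurable_from_subalg[OF subalg] a X bound)
  then show "integrable M (\<lambda>\<omega>. \<Sum>j\<in>J. a j \<omega> * X j \<omega>)"
    by (intro Bochner_Integration.integrable_sum)
  \<comment> \<open>Padding with 0 outside \<open>J\<close> makes every member of the family
    integrable, as \<open>real_cond_exp_sum\<close> asks.\<close>
  define Z where "Z j = (\<lambda>\<omega>. if j \<in> J then a j \<omega> * X j \<omega> else 0)" for j
  have "integrable M (Z j)" for j
    by (cases "j \<in> J") (simp_all add: Z_def int)
  then have "AE \<omega> in M. real_cond_exp M F (\<lambda>\<omega>. \<Sum>j\<in>J. Z j \<omega>) \<omega> = (\<Sum>j\<in>J. real_cond_exp M F (Z j) \<omega>)"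
    by (rule real_cond_exp_sum)
  moreover have "AE \<omega> in M. \<forall>j\<in>J. real_cond_exp M F (Z j) \<omega> = a j \<omega> * real_cond_exp M F (X j) \<omega>"
  proof (rule AE_finite_allI[OF J])
    fix j assume "j \<in> J"
    then show "AE \<omega> in M. real_cond_exp M F (Z j) \<omega> = a j \<omega> * real_cond_exp M F (X j) \<omega>"
      using a X int by (simp add: Z_def real_cond_exp_mult)
  qed
  ultimately have "AE \<omega> in M. real_cond_exp M F (\<lambda>\<omega>. \<Sum>j\<in>J. Z j \<omega>) \<omega>
      = (\<Sum>j\<in>J. a j \<omega> * real_cond_exp M F (X j) \<omega>)"
    by eventually_elim simp
  then show "AE \<omega> in M. real_cond_exp M F (\<lambda>\<omega>. \<Sum>j\<in>J. a j \<omega> * X j \<omega>) \<omega>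
      = (\<Sum>j\<in>J. a j \<omega> * real_cond_exp M F (X j) \<omega>)"
    by (simp add: Z_def)
qed

end

subsection \<open>Generated algebras\<close>

lemma sets_generated_algebra:
  "sets (generated_algebra M XS) = sigma_sets (space M) {X -` B \<inter> space M | X B. X \<in> XS \<and> B \<in> sets borel}"
  unfolding generated_algebra_def by (intro sets_measure_of) auto

lemma space_generated_algebra [simp]: "space (generated_algebra M XS) = space M"
  unfolding generated_algebra_def by (intro space_measure_of) auto

lemma subalgebra_generated_algebra:
  assumes "XS \<subseteq> borel_measurable M"
  shows "subalgebra M (generated_algebra M XS)"
  unfolding subalgebra_def sets_generated_algebra space_generated_algebra
  using assms by (intro conjI refl sets.sigma_sets_subset) (auto intro: measurable_sets)

lemma subalgebra_generated_algebra_mono: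
  "XS \<subseteq> YS \<Longrightarrow> subalgebra (generated_algebra M YS) (generated_algebra M XS)"
  unfolding subalgebra_def sets_generated_algebra space_generated_algebra
  by (intro conjI refl sigma_sets_mono') auto

lemma generated_algebra_measurable:
  "X \<in> XS \<Longrightarrow> X \<in> borel_measurable (generated_algebra M XS)"
  by (rule measurableI) (auto simp: sets_generated_algebra intro!: sigma_sets.Basic)

subsection \<open>Measurability of the two passes\<close>

context regular_network
begin

lemma finite_weight_index: "finite (weight_index N dw)"
  by (simp add: weight_index_def)

text \<open>The algebra \<open>A\<close> is arbitrary: measurability is needed in \<open>M\<close>
  to see that the generated algebras are subalgebras, and in \<open>G i\<close> and
  \<open>G N\<close> to pull terms out of conditional expectations. Both layer outputs and Jacobian
  entries are differentiable functions of the layer arguments.\<close>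

lemma layer_differentiable_measurable:
  assumes i: "i < N"
    and g: "\<And>z. z \<in> vecs ({..<d i} <+> {..<dw (Suc i)}) \<Longrightarrow>
      frechet_diff_at ({..<d i} <+> {..<dw (Suc i)}) g z"
    and W: "\<And>\<omega>. \<omega> \<in> space A \<Longrightarrow> W \<omega> \<in> vecs (weight_index N dw)"
    and y: "\<And>\<omega>. \<omega> \<in> space A \<Longrightarrow> y \<omega> \<in> vecs {..<d i}"
    and W_meas: "\<And>p. p \<in> weight_index N dw \<Longrightarrow> (\<lambda>\<omega>. W \<omega> p) \<in> borel_measurable A"
    and y_meas: "\<And>k. k < d i \<Longrightarrow> (\<lambda>\<omega>. y \<omega> k) \<in> borel_measurable A"
  shows "(\<lambda>\<omega>. g (case_sum (y \<omega>) (layer_weight (W \<omega>) (Suc i)))) \<in> borel_measurable A"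
proof (rule borel_measurable_differentiable[OF _ g])
  show "case_sum (y \<omega>) (layer_weight (W \<omega>) (Suc i)) \<in> vecs ({..<d i} <+> {..<dw (Suc i)})"
    if "\<omega> \<in> space A" for \<omega>
    using that by (intro case_sum_vecs y layer_weight_vecs W)
  show "(\<lambda>\<omega>. case_sum (y \<omega>) (layer_weight (W \<omega>) (Suc i)) k) \<in> borel_measurable A"
    if "k \<in> {..<d i} <+> {..<dw (Suc i)}" for k
    using that i y_meas W_meas by (auto simp: layer_weight_def weight_index_def)
qed simp_all

lemma layer_value_measurable:
  assumes "i < N" "j < d (Suc i)"
    and "\<And>\<omega>. \<omega> \<in> space A \<Longrightarrow> W \<omega> \<in> vecs (weight_index N dw)"
    and "\<And>\<omega>. \<omega> \<in> space A \<Longrightarrow> y \<omega> \<in> vecs {..<d i}"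
    and "\<And>p. p \<in> weight_index N dw \<Longrightarrow> (\<lambda>\<omega>. W \<omega> p) \<in> borel_measurable A"
    and "\<And>k. k < d i \<Longrightarrow> (\<lambda>\<omega>. y \<omega> k) \<in> borel_measurable A"
  shows "(\<lambda>\<omega>. f (Suc i) (y \<omega>) (layer_weight (W \<omega>) (Suc i)) j) \<in> borel_measurable A"
proof -
  have "(\<lambda>\<omega>. comp_fun (f (Suc i)) j (case_sum (y \<omega>) (layer_weight (W \<omega>) (Suc i)))) \<in> borel_measurable A"
    using twice_diff[OF assms(1)] assms
    by (intro layer_differentiable_measurable) (auto simp: twice_diff_operator_def)
  then show ?thesis
    by (simp add: comp_fun_def comp_def)
qed

lemma layer_jac_measurable:
  assumes "i < N" "j < d (Suc i)" "c \<in> {..<d i} <+> {..<dw (Suc i)}"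
    and "\<And>\<omega>. \<omega> \<in> space A \<Longrightarrow> W \<omega> \<in> vecs (weight_index N dw)"
    and "\<And>\<omega>. \<omega> \<in> space A \<Longrightarrow> y \<omega> \<in> vecs {..<d i}"
    and "\<And>p. p \<in> weight_index N dw \<Longrightarrow> (\<lambda>\<omega>. W \<omega> p) \<in> borel_measurable A"
    and "\<And>k. k < d i \<Longrightarrow> (\<lambda>\<omega>. y \<omega> k) \<in> borel_measurable A"
  shows "(\<lambda>\<omega>. jac (f (Suc i)) (case_sum (y \<omega>) (layer_weight (W \<omega>) (Suc i))) j c) \<in> borel_measurable A"
  using twice_diff[OF assms(1)] assms(2,3)
  by (intro layer_differentiable_measurable assms) (auto simp: twice_diff_operator_def)

lemma forward_measurable:
  assumes W: "\<And>\<omega>. \<omega> \<in> space A \<Longrightarrow> W \<omega> \<in> vecs (weight_index N dw)"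
    and X: "\<And>\<omega>. \<omega> \<in> space A \<Longrightarrow> X \<omega> \<in> vecs {..<d 0}"
    and D: "\<And>\<omega> i. \<omega> \<in> space A \<Longrightarrow> 1 \<le> i \<Longrightarrow> i \<le> N \<Longrightarrow> D \<omega> i \<in> vecs {..<d i}"
    and W_meas: "\<And>p. p \<in> weight_index N dw \<Longrightarrow> (\<lambda>\<omega>. W \<omega> p) \<in> borel_measurable A"
    and X_meas: "\<And>k. k < d 0 \<Longrightarrow> (\<lambda>\<omega>. X \<omega> k) \<in> borel_measurable A"
    and D_meas: "\<And>i k. 1 \<le> i \<Longrightarrow> i \<le> N \<Longrightarrow> k < d i \<Longrightarrow> (\<lambda>\<omega>. D \<omega> i k) \<in> borel_measurable A"
    and "i \<le> N" "k < d i"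
  shows "(\<lambda>\<omega>. forward f (W \<omega>) (X \<omega>) (D \<omega>) i k) \<in> borel_measurable A"
  using \<open>i \<le> N\<close> \<open>k < d i\<close>
proof (induction i arbitrary: k)
  case 0
  then show ?case using X_meas by simp
next
  case (Suc i)
  then have "(\<lambda>\<omega>. f (Suc i) (forward f (W \<omega>) (X \<omega>) (D \<omega>) i) (layer_weight (W \<omega>) (Suc i)) k)
      \<in> borel_measurable A"
    by (intro layer_value_measurable W W_meas forward_vecs X D) auto
  then show ?case
    using Suc D_meas[of "Suc i" k] by auto
qed

lemma backward_measurable:
  assumes W: "\<And>\<omega>. \<omega> \<in> space A \<Longrightarrow> W \<omega> \<in> vecs (weight_index N dw)"
    and Y: "\<And>\<omega> i. \<omega> \<in> space A \<Longrightarrow> i < N \<Longrightarrow> Y \<omega> i \<in> vecs {..<d i}"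
    and W_meas: "\<And>p. p \<in> weight_index N dw \<Longrightarrow> (\<lambda>\<omega>. W \<omega> p) \<in> borel_measurable A"
    and Y_meas: "\<And>i k. i < N \<Longrightarrow> k < d i \<Longrightarrow> (\<lambda>\<omega>. Y \<omega> i k) \<in> borel_measurable A"
    and E_meas: "\<And>i k. 1 \<le> i \<Longrightarrow> i < N \<Longrightarrow> k < d i \<Longrightarrow> (\<lambda>\<omega>. E \<omega> (Suc i) k) \<in> borel_measurable A"
    and l: "1 \<le> l" "l \<le> N" "k < d l"
  shows "(\<lambda>\<omega>. backward N d f (W \<omega>) (Y \<omega>) (E \<omega>) l k) \<in> borel_measurable A"
  using l(2,1,3)
proof (induction arbitrary: k rule: inc_induct)
  case base
  then show ?case by (simp add: backward_last)
next
  case (step l)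
  have "(\<lambda>\<omega>. layer_jac1 (W \<omega>) (Y \<omega>) l j k) \<in> borel_measurable A" if "j < d (Suc l)" for j
    unfolding jac1_def using step that by (intro layer_jac_measurable W W_meas Y Y_meas) auto
  then show ?case
    using step E_meas[of l k] by (simp add: backward_step) measurable
qed

lemma stacked_grad_measurable:
  assumes W: "\<And>\<omega>. \<omega> \<in> space A \<Longrightarrow> W \<omega> \<in> vecs (weight_index N dw)"
    and X: "\<And>\<omega>. \<omega> \<in> space A \<Longrightarrow> X \<omega> \<in> vecs {..<d 0}"
    and D: "\<And>\<omega> i. \<omega> \<in> space A \<Longrightarrow> 1 \<le> i \<Longrightarrow> i \<le> N \<Longrightarrow> D \<omega> i \<in> vecs {..<d i}"
    and W_meas: "\<And>p. p \<in> weight_index N dw \<Longrightarrow> (\<lambda>\<omega>. W \<omega> p) \<in> borel_measurable A"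
    and X_meas: "\<And>k. k < d 0 \<Longrightarrow> (\<lambda>\<omega>. X \<omega> k) \<in> borel_measurable A"
    and D_meas: "\<And>i k. 1 \<le> i \<Longrightarrow> i \<le> N \<Longrightarrow> k < d i \<Longrightarrow> (\<lambda>\<omega>. D \<omega> i k) \<in> borel_measurable A"
    and E_meas: "\<And>i k. 1 \<le> i \<Longrightarrow> i < N \<Longrightarrow> k < d i \<Longrightarrow> (\<lambda>\<omega>. E \<omega> (Suc i) k) \<in> borel_measurable A"
    and p: "p \<in> weight_index N dw"
  shows "(\<lambda>\<omega>. stacked_grad N d f (W \<omega>) (X \<omega>) (D \<omega>) (E \<omega>) p) \<in> borel_measurable A"
proof -
  obtain i k where i: "p = (Suc i, k)" "i < N" "k < dw (Suc i)"
    using p unfolding weight_index_def by (cases p, cases "fst p") auto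
  have Y: "forward f (W \<omega>) (X \<omega>) (D \<omega>) i \<in> vecs {..<d i}" if "\<omega> \<in> space A" "i < N" for \<omega> i
    using that by (intro forward_vecs W X D) auto
  have Y_meas: "(\<lambda>\<omega>. forward f (W \<omega>) (X \<omega>) (D \<omega>) i k) \<in> borel_measurable A" if "i < N" "k < d i" for i k
    using that by (intro forward_measurable W X D W_meas X_meas D_meas) auto
  have "(\<lambda>\<omega>. layer_jac2 (W \<omega>) (forward f (W \<omega>) (X \<omega>) (D \<omega>)) i j k) \<in> borel_measurable A"
    if "j < d (Suc i)" for j
    unfolding jac2_def using that i by (intro layer_jac_measurable W W_meas Y Y_meas) auto
  moreover have "(\<lambda>\<omega>. backward N d f (W \<omega>) (forward f (W \<omega>) (X \<omega>) (D \<omega>)) (E \<omega>) (Suc i) j) \<in> borel_measurable A"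
    if "j < d (Suc i)" for j
    using that i by (intro backward_measurable W W_meas Y Y_meas E_meas) auto
  ultimately show ?thesis
    unfolding i(1) stacked_grad_Suc by (intro borel_measurable_sum borel_measurable_times) auto
qed

end

subsection \<open>The bias of one perturbed step\<close>

text \<open>The generators are abstracted away: what remains are the inclusions of \<open>F\<close>
  in \<open>G i\<close>, of \<open>G i\<close> in \<open>G N\<close>, of \<open>G N\<close> in
  \<open>H l\<close>, and the measurability of weights, sample and perturbed outputs.
  \<open>E \<omega> (Suc i)\<close> perturbs the backward vector of layer i, so its layer index runs
  from 2 to N.\<close>

locale perturbed_step = regular_network + prob_space M for M :: "'a measure" +
  fixes F :: "'a measure" and G H :: "nat \<Rightarrow> 'a measure"
    and W :: "'a \<Rightarrow> nat \<times> nat \<Rightarrow> real" and X :: "'a \<Rightarrow> rvec" and D E :: "'a \<Rightarrow> nat \<Rightarrow> rvec"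
  assumes F_G: "i \<le> N \<Longrightarrow> subalgebra (G i) F" and G_G: "i \<le> N \<Longrightarrow> subalgebra (G N) (G i)"
    and G_H: "1 \<le> i \<Longrightarrow> i \<le> N \<Longrightarrow> subalgebra (H i) (G N)"
    and M_H: "1 \<le> i \<Longrightarrow> i \<le> N \<Longrightarrow> subalgebra M (H i)"
    and W: "\<omega> \<in> space M \<Longrightarrow> W \<omega> \<in> vecs (weight_index N dw)"
    and X: "\<omega> \<in> space M \<Longrightarrow> X \<omega> \<in> vecs {..<d 0}"
    and D: "\<omega> \<in> space M \<Longrightarrow> 1 \<le> i \<Longrightarrow> i \<le> N \<Longrightarrow> D \<omega> i \<in> vecs {..<d i}"
    and W_meas: "p \<in> weight_index N dw \<Longrightarrow> (\<lambda>\<omega>. W \<omega> p) \<in> borel_measurable F"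
    and X_meas: "k < d 0 \<Longrightarrow> (\<lambda>\<omega>. X \<omega> k) \<in> borel_measurable F"
    and Y_meas: "1 \<le> j \<Longrightarrow> j \<le> i \<Longrightarrow> i \<le> N \<Longrightarrow> k < d j \<Longrightarrow>
      (\<lambda>\<omega>. forward f (W \<omega>) (X \<omega>) (D \<omega>) j k) \<in> borel_measurable (G i)"
    and D_int: "1 \<le> i \<Longrightarrow> i \<le> N \<Longrightarrow> k < d i \<Longrightarrow> integrable M (\<lambda>\<omega>. D \<omega> i k)"
    and E_int: "1 \<le> i \<Longrightarrow> i < N \<Longrightarrow> k < d i \<Longrightarrow> integrable M (\<lambda>\<omega>. E \<omega> (Suc i) k)"
begin

abbreviation "Y \<omega> \<equiv> forward f (W \<omega>) (X \<omega>) (D \<omega>)"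

lemma M_G: "i \<le> N \<Longrightarrow> subalgebra M (G i)"
  using G_G[of i] G_H[of N] M_H[of N] N by (auto simp: subalgebra_def)

lemma M_F: "subalgebra M F"
  using F_G[of 0] M_G[of 0] by (auto simp: subalgebra_def)

lemma space_G: "i \<le> N \<Longrightarrow> space (G i) = space M"
  using M_G[of i] by (simp add: subalgebra_def)

lemma sigma_finite_subalgebra: "subalgebra M A \<Longrightarrow> sigma_finite_subalgebra M A"
  by (intro finite_measure_subalgebra_is_sigma_finite finite_measure_subalgebra.intro
      finite_measure_axioms finite_measure_subalgebra_axioms.intro)

lemma W_meas_G: "i \<le> N \<Longrightarrow> p \<in> weight_index N dw \<Longrightarrow> (\<lambda>\<omega>. W \<omega> p) \<in> borel_measurable (G i)"
  by (rule measurable_from_subalg[OF F_G W_meas])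

lemma Y_meas_G:
  assumes "j \<le> i" "i \<le> N" "k < d j"
  shows "(\<lambda>\<omega>. Y \<omega> j k) \<in> borel_measurable (G i)"
proof (cases j)
  case 0
  then show ?thesis
    using assms measurable_from_subalg[OF F_G X_meas] by simp
next
  case (Suc j')
  then show ?thesis
    using assms by (intro Y_meas) auto
qed

lemma Y_vecs: "\<omega> \<in> space M \<Longrightarrow> i \<le> N \<Longrightarrow> Y \<omega> i \<in> vecs {..<d i}"
  by (intro forward_vecs W X D)

lemma D_meas_G:
  assumes "1 \<le> i" "i \<le> N" "k < d i"
  shows "(\<lambda>\<omega>. D \<omega> i k) \<in> borel_measurable (G i)"
proof -
  obtain j where j: "i = Suc j"
    using assms by (cases i) auto
  have "(\<lambda>\<omega>. f (Suc j) (Y \<omega> j) (layer_weight (W \<omega>) (Suc j)) k) \<in> borel_measurable (G i)"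
    using assms j by (intro layer_value_measurable W Y_vecs W_meas_G Y_meas_G) (auto simp: space_G)
  moreover have "(\<lambda>\<omega>. Y \<omega> i k) \<in> borel_measurable (G i)"
    using assms by (intro Y_meas_G) auto
  ultimately have "(\<lambda>\<omega>. Y \<omega> i k - f (Suc j) (Y \<omega> j) (layer_weight (W \<omega>) (Suc j)) k) \<in> borel_measurable (G i)"
    by (rule borel_measurable_diff[rotated])
  then show ?thesis
    by (simp add: j)
qed

lemma norm_moment_cond_exp_D:
  assumes "1 \<le> i" "i \<le> N"
  shows "norm_moment M 2 {..<d i} (vec_cond_exp M (G i) (\<lambda>\<omega>. D \<omega> i)) = norm_moment M 2 {..<d i} (\<lambda>\<omega>. D \<omega> i)"
proof (rule norm_moment_AE_cong)
  interpret G: sigma_finite_subalgebra M "G i"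
    using assms by (intro sigma_finite_subalgebra M_G)
  show "AE \<omega> in M. \<forall>k\<in>{..<d i}. vec_cond_exp M (G i) (\<lambda>\<omega>. D \<omega> i) \<omega> k = D \<omega> i k"
    unfolding vec_cond_exp_def using assms
    by (intro AE_finite_allI G.real_cond_exp_F_meas D_int D_meas_G) auto
qed

text \<open>Measurability in \<open>G N\<close> and boundedness are the two conditions for pulling
  Jacobian entries out of the conditional expectation. \<open>Y'\<close> is free, so exact and
  perturbed forward outputs are both covered.\<close>

lemma
  assumes Y': "\<And>\<omega> i. \<omega> \<in> space M \<Longrightarrow> i < N \<Longrightarrow> Y' \<omega> i \<in> vecs {..<d i}"
    and Y'_meas: "\<And>i k. i < N \<Longrightarrow> k < d i \<Longrightarrow> (\<lambda>\<omega>. Y' \<omega> i k) \<in> borel_measurable (G N)"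
    and i: "i < N" "j < d (Suc i)"
  shows layer_jac1_meas: "k < d i \<Longrightarrow> (\<lambda>\<omega>. layer_jac1 (W \<omega>) (Y' \<omega>) i j k) \<in> borel_measurable (G N)"
    and layer_jac2_meas: "k < dw (Suc i) \<Longrightarrow> (\<lambda>\<omega>. layer_jac2 (W \<omega>) (Y' \<omega>) i j k) \<in> borel_measurable (G N)"
    and layer_jac1_le: "k < d i \<Longrightarrow> \<omega> \<in> space M \<Longrightarrow> \<bar>layer_jac1 (W \<omega>) (Y' \<omega>) i j k\<bar> \<le> C1"
    and layer_jac2_le: "k < dw (Suc i) \<Longrightarrow> \<omega> \<in> space M \<Longrightarrow> \<bar>layer_jac2 (W \<omega>) (Y' \<omega>) i j k\<bar> \<le> C1"
proof -
  show "k < d i \<Longrightarrow> (\<lambda>\<omega>. layer_jac1 (W \<omega>) (Y' \<omega>) i j k) \<in> borel_measurable (G N)"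
    unfolding jac1_def using i by (intro layer_jac_measurable W Y' W_meas_G Y'_meas) (auto simp: space_G)
  show "k < dw (Suc i) \<Longrightarrow> (\<lambda>\<omega>. layer_jac2 (W \<omega>) (Y' \<omega>) i j k) \<in> borel_measurable (G N)"
    unfolding jac2_def using i by (intro layer_jac_measurable W Y' W_meas_G Y'_meas) (auto simp: space_G)
  show "k < d i \<Longrightarrow> \<omega> \<in> space M \<Longrightarrow> \<bar>layer_jac1 (W \<omega>) (Y' \<omega>) i j k\<bar> \<le> C1"
    using i by (intro abs_entry_le_op_norm[OF _ _ jac1_bound] layer_weight_vecs W Y') auto
  show "k < dw (Suc i) \<Longrightarrow> \<omega> \<in> space M \<Longrightarrow> \<bar>layer_jac2 (W \<omega>) (Y' \<omega>) i j k\<bar> \<le> C1"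
    using i by (intro abs_entry_le_op_norm[OF _ _ jac2_bound] layer_weight_vecs W Y') auto
qed

text \<open>Each step multiplies by bounded entries and adds an integrable perturbation, so first
  moments propagate without any assumption on second moments.\<close>

lemma backward_integrable:
  assumes Y': "\<And>\<omega> i. \<omega> \<in> space M \<Longrightarrow> i < N \<Longrightarrow> Y' \<omega> i \<in> vecs {..<d i}"
    and Y'_meas: "\<And>i k. i < N \<Longrightarrow> k < d i \<Longrightarrow> (\<lambda>\<omega>. Y' \<omega> i k) \<in> borel_measurable (G N)"
    and E': "\<And>i k. 1 \<le> i \<Longrightarrow> i < N \<Longrightarrow> k < d i \<Longrightarrow> integrable M (\<lambda>\<omega>. E' \<omega> (Suc i) k)"
    and l: "1 \<le> l" "l \<le> N" "k < d l"
  shows "integrable M (\<lambda>\<omega>. backward N d f (W \<omega>) (Y' \<omega>) (E' \<omega>) l k)"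
  using l(2,1,3)
proof (induction arbitrary: k rule: inc_induct)
  case base
  then show ?case by (simp add: backward_last)
next
  case (step l)
  interpret G: sigma_finite_subalgebra M "G N"
    by (intro sigma_finite_subalgebra M_G) simp
  have "integrable M (\<lambda>\<omega>. \<Sum>j\<in>{..<d (Suc l)}.
      layer_jac1 (W \<omega>) (Y' \<omega>) l j k * backward N d f (W \<omega>) (Y' \<omega>) (E' \<omega>) (Suc l) j)"
    using step
    by (intro G.real_cond_exp_linear_combination(1)[where C = C1] layer_jac1_meas layer_jac1_le Y' Y'_meas) auto
  then show ?case
    using step E'[of l k] by (simp add: backward_step)
qed

text \<open>\<open>D'\<close> and \<open>E'\<close> are free so that the perturbed, the intermediate
  and the unperturbed gradient are all instances.\<close>

lemma stacked_grad_integrable: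
  assumes D': "\<And>\<omega> i. \<omega> \<in> space M \<Longrightarrow> 1 \<le> i \<Longrightarrow> i \<le> N \<Longrightarrow> D' \<omega> i \<in> vecs {..<d i}"
    and D'_meas: "\<And>i k. 1 \<le> i \<Longrightarrow> i \<le> N \<Longrightarrow> k < d i \<Longrightarrow> (\<lambda>\<omega>. D' \<omega> i k) \<in> borel_measurable (G N)"
    and E': "\<And>i k. 1 \<le> i \<Longrightarrow> i < N \<Longrightarrow> k < d i \<Longrightarrow> integrable M (\<lambda>\<omega>. E' \<omega> (Suc i) k)"
    and p: "p \<in> weight_index N dw"
  shows "integrable M (\<lambda>\<omega>. stacked_grad N d f (W \<omega>) (X \<omega>) (D' \<omega>) (E' \<omega>) p)"
proof -
  interpret G: sigma_finite_subalgebra M "G N"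
    by (intro sigma_finite_subalgebra M_G) simp
  obtain i k where i: "p = (Suc i, k)" "i < N" "k < dw (Suc i)"
    using p unfolding weight_index_def by (cases p, cases "fst p") auto
  have Y': "forward f (W \<omega>) (X \<omega>) (D' \<omega>) i \<in> vecs {..<d i}" if "\<omega> \<in> space M" "i < N" for \<omega> i
    using that by (intro forward_vecs W X D') auto
  have Y'_meas: "(\<lambda>\<omega>. forward f (W \<omega>) (X \<omega>) (D' \<omega>) i k) \<in> borel_measurable (G N)" if "i < N" "k < d i" for i k
    using that
    by (intro forward_measurable W X D' W_meas_G D'_meas measurable_from_subalg[OF F_G X_meas])
      (auto simp: space_G)
  show ?thesis
    unfolding i(1) stacked_grad_Suc using i
    by (intro G.real_cond_exp_linear_combination(1)[where C = C1] layer_jac2_meas layer_jac2_le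
        backward_integrable Y' Y'_meas E') auto
qed

definition backward_bias :: "'a \<Rightarrow> nat \<times> nat \<Rightarrow> real" where
  "backward_bias \<omega> p = stacked_grad N d f (W \<omega>) (X \<omega>) (D \<omega>) (E \<omega>) p
     - stacked_grad N d f (W \<omega>) (X \<omega>) (D \<omega>) (\<lambda>_ _. 0) p"

definition forward_bias :: "'a \<Rightarrow> nat \<times> nat \<Rightarrow> real" where
  "forward_bias \<omega> p = stacked_grad N d f (W \<omega>) (X \<omega>) (D \<omega>) (\<lambda>_ _. 0) p
     - stacked_grad N d f (W \<omega>) (X \<omega>) (\<lambda>_ _. 0) (\<lambda>_ _. 0) p"

lemma D_meas_GN: "1 \<le> i \<Longrightarrow> i \<le> N \<Longrightarrow> k < d i \<Longrightarrow> (\<lambda>\<omega>. D \<omega> i k) \<in> borel_measurable (G N)"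
  by (rule measurable_from_subalg[OF G_G D_meas_G])

lemma backward_bias_integrable: "p \<in> weight_index N dw \<Longrightarrow> integrable M (\<lambda>\<omega>. backward_bias \<omega> p)"
  unfolding backward_bias_def
  by (intro Bochner_Integration.integrable_diff stacked_grad_integrable D D_meas_GN E_int) auto

lemma forward_bias_integrable: "p \<in> weight_index N dw \<Longrightarrow> integrable M (\<lambda>\<omega>. forward_bias \<omega> p)"
  unfolding forward_bias_def
  by (intro Bochner_Integration.integrable_diff stacked_grad_integrable D D_meas_GN)
    (auto simp: vecs_def)

lemma forward_bias_moment:
  "2 * norm_moment M 2 (weight_index N dw) forward_bias
    \<le> (\<Sum>i=1..N - 1. ennreal (Cb_delta N C1 C2 i) * norm_moment M 2 {..<d i} (\<lambda>\<omega>. D \<omega> i))"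
proof (rule norm_moment_2_le_sum)
  show "0 \<le> Cb_delta N C1 C2 i" for i
    by (simp add: Cb_delta_def sum_nonneg)
  show "(\<lambda>\<omega>. D \<omega> i k) \<in> borel_measurable M" if "i \<in> {1..N - 1}" "k \<in> {..<d i}" for i k
    using D_int[of i k] that by auto
  show "AE \<omega> in M. 2 * (\<Sum>k\<in>weight_index N dw. (forward_bias \<omega> k)\<^sup>2)
      \<le> (\<Sum>i=1..N - 1. Cb_delta N C1 C2 i * (L2_set (D \<omega> i) {..<d i})\<^sup>2)"
    unfolding forward_bias_def
    by (intro AE_I2 forward_perturbation_grad_bound W X D)
  show "(\<lambda>\<omega>. forward_bias \<omega> p) \<in> borel_measurable M" if "p \<in> weight_index N dw" for p
    using forward_bias_integrable[OF that] by auto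
qed simp

lemma backward_bias_moment:
  "2 * norm_moment M 2 (weight_index N dw) (vec_cond_exp M (G N) backward_bias)
    \<le> (\<Sum>i=1..N - 1. ennreal (Cb_eps C1 (i + 1)) *
          norm_moment M 2 {..<d i} (vec_cond_exp M (G N) (\<lambda>\<omega>. E \<omega> (i + 1))))"
proof (rule norm_moment_2_le_sum)
  interpret G: sigma_finite_subalgebra M "G N"
    by (intro sigma_finite_subalgebra M_G) simp
  show "0 \<le> Cb_eps C1 (i + 1)" for i
    by (simp add: Cb_eps_def sum_nonneg)
  define u where "u l k \<omega> = backward N d f (W \<omega>) (Y \<omega>) (E \<omega>) l k - backward N d f (W \<omega>) (Y \<omega>) (\<lambda>_ _. 0) l k"
    for l k \<omega>
  define m where "m \<omega> l k = real_cond_exp M (G N) (u l k) \<omega>" for \<omega> l k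
  have Y_lt: "Y \<omega> i \<in> vecs {..<d i}" if "\<omega> \<in> space M" "i < N" for \<omega> i
    using that by (intro Y_vecs) auto
  have Y_meas_lt: "(\<lambda>\<omega>. Y \<omega> i k) \<in> borel_measurable (G N)" if "i < N" "k < d i" for i k
    using that by (intro Y_meas_G) auto
  have u_int: "integrable M (u l k)" if "1 \<le> l" "l \<le> N" "k < d l" for l k
    unfolding u_def using that
    by (intro Bochner_Integration.integrable_diff backward_integrable Y_lt Y_meas_lt E_int) auto
  have m_N: "AE \<omega> in M. \<forall>k. k < d N \<longrightarrow> m \<omega> N k = 0"
  proof -
    have "u N k = (\<lambda>_. 0)" for k
      by (simp add: u_def backward_last fun_eq_iff)
    moreover have "AE \<omega> in M. real_cond_exp M (G N) (\<lambda>_. 0) \<omega> = 0"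
      by (intro G.real_cond_exp_F_meas) auto
    ultimately show ?thesis
      unfolding m_def by (elim AE_mp) auto
  qed
  \<comment> \<open>The quantifiers stay inside \<open>AE\<close>: countably many null sets are
    discarded at once, so the deterministic estimate applies at almost every sample point.\<close>
  have m_step: "AE \<omega> in M. \<forall>l k. 1 \<le> l \<longrightarrow> l < N \<longrightarrow> k < d l \<longrightarrow>
      m \<omega> l k = (\<Sum>j<d (Suc l). layer_jac1 (W \<omega>) (Y \<omega>) l j k * m \<omega> (Suc l) j)
        + vec_cond_exp M (G N) (\<lambda>\<omega>. E \<omega> (Suc l)) \<omega> k"
  proof (unfold AE_all_countable, intro allI AE_impI)
    fix l k assume l: "1 \<le> l" "l < N" "k < d l"
    \<comment> \<open>Both backward passes use the same forward outputs, hence the same Jacobians.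
      Their difference is therefore linear in the perturbations, and no second derivative
      appears.\<close>
    have eq: "u l k = (\<lambda>\<omega>. (\<Sum>j<d (Suc l). layer_jac1 (W \<omega>) (Y \<omega>) l j k * u (Suc l) j \<omega>) + E \<omega> (Suc l) k)"
      using l by (simp add: u_def backward_step right_diff_distrib sum_subtractf fun_eq_iff)
    have lin: "integrable M (\<lambda>\<omega>. \<Sum>j<d (Suc l). layer_jac1 (W \<omega>) (Y \<omega>) l j k * u (Suc l) j \<omega>)"
      "AE \<omega> in M. real_cond_exp M (G N) (\<lambda>\<omega>. \<Sum>j<d (Suc l). layer_jac1 (W \<omega>) (Y \<omega>) l j k * u (Suc l) j \<omega>) \<omega>
        = (\<Sum>j<d (Suc l). layer_jac1 (W \<omega>) (Y \<omega>) l j k * m \<omega> (Suc l) j)"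
      unfolding m_def using l
      by (intro G.real_cond_exp_linear_combination[where C = C1] layer_jac1_meas layer_jac1_le Y_lt Y_meas_lt u_int;
          force)+
    have "AE \<omega> in M. m \<omega> l k
        = real_cond_exp M (G N) (\<lambda>\<omega>. \<Sum>j<d (Suc l). layer_jac1 (W \<omega>) (Y \<omega>) l j k * u (Suc l) j \<omega>) \<omega>
          + vec_cond_exp M (G N) (\<lambda>\<omega>. E \<omega> (Suc l)) \<omega> k"
      unfolding m_def vec_cond_exp_def eq using l lin(1)
      by (intro G.real_cond_exp_add E_int) auto
    then show "AE \<omega> in M. m \<omega> l k = (\<Sum>j<d (Suc l). layer_jac1 (W \<omega>) (Y \<omega>) l j k * m \<omega> (Suc l) j)
        + vec_cond_exp M (G N) (\<lambda>\<omega>. E \<omega> (Suc l)) \<omega> k"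
      using lin(2) by eventually_elim simp
  qed
  have g_eq: "AE \<omega> in M. \<forall>i k. i < N \<longrightarrow> k < dw (Suc i) \<longrightarrow>
      vec_cond_exp M (G N) backward_bias \<omega> (Suc i, k)
        = (\<Sum>j<d (Suc i). layer_jac2 (W \<omega>) (Y \<omega>) i j k * m \<omega> (Suc i) j)"
  proof (unfold AE_all_countable, intro allI AE_impI)
    fix i k assume i: "i < N" "k < dw (Suc i)"
    have eq: "(\<lambda>\<omega>. backward_bias \<omega> (Suc i, k))
        = (\<lambda>\<omega>. \<Sum>j<d (Suc i). layer_jac2 (W \<omega>) (Y \<omega>) i j k * u (Suc i) j \<omega>)"
      by (simp add: backward_bias_def stacked_grad_Suc u_def right_diff_distrib sum_subtractf)
    show "AE \<omega> in M. vec_cond_exp M (G N) backward_bias \<omega> (Suc i, k)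
        = (\<Sum>j<d (Suc i). layer_jac2 (W \<omega>) (Y \<omega>) i j k * m \<omega> (Suc i) j)"
      unfolding vec_cond_exp_def m_def eq using i
      by (intro G.real_cond_exp_linear_combination[where C = C1] layer_jac2_meas layer_jac2_le Y_lt Y_meas_lt u_int;
          force)
  qed
  show "AE \<omega> in M. 2 * (\<Sum>p\<in>weight_index N dw. (vec_cond_exp M (G N) backward_bias \<omega> p)\<^sup>2)
      \<le> (\<Sum>i=1..N - 1. Cb_eps C1 (i + 1) *
          (L2_set (vec_cond_exp M (G N) (\<lambda>\<omega>. E \<omega> (i + 1)) \<omega>) {..<d i})\<^sup>2)"
    using m_N m_step g_eq AE_space
  proof eventually_elim
    case (elim \<omega>)
    show ?case
      by (rule backward_perturbation_grad_bound[where W = "W \<omega>" and Y = "Y \<omega>" and m = "m \<omega>"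
            and e = "\<lambda>l. vec_cond_exp M (G N) (\<lambda>\<omega>. E \<omega> l) \<omega>"])
        (use elim W Y_lt in auto)
  qed
qed (auto simp: vec_cond_exp_def)

text \<open>Second moments of conditional expectations grow with the algebra. For the backward
  error, \<open>F\<close> is first refined to \<open>G N\<close>, where the recursion holds, and
  then \<open>G N\<close> to \<open>H (i + 1)\<close>. For the forward error, conditioning is
  dropped before the pointwise estimate.\<close>

theorem bias_moment:
  "norm_moment M 2 (weight_index N dw) (vec_cond_exp M F
      (\<lambda>\<omega> p. stacked_grad N d f (W \<omega>) (X \<omega>) (D \<omega>) (E \<omega>) p
        - stacked_grad N d f (W \<omega>) (X \<omega>) (\<lambda>_ _. 0) (\<lambda>_ _. 0) p))
    \<le> (\<Sum>i=1..N - 1. ennreal (Cb_delta N C1 C2 i) *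
          norm_moment M 2 {..<d i} (vec_cond_exp M (G i) (\<lambda>\<omega>. D \<omega> i)))
      + (\<Sum>i=1..N - 1. ennreal (Cb_eps C1 (i + 1)) *
          norm_moment M 2 {..<d i} (vec_cond_exp M (H (i + 1)) (\<lambda>\<omega>. E \<omega> (i + 1))))"
    (is "norm_moment M 2 ?K (vec_cond_exp M F ?U) \<le> ?SD + ?SE")
proof -
  interpret F: sigma_finite_subalgebra M F
    by (rule sigma_finite_subalgebra[OF M_F])
  interpret G: sigma_finite_subalgebra M "G N"
    by (intro sigma_finite_subalgebra M_G) simp
  have U: "?U = (\<lambda>\<omega> p. backward_bias \<omega> p + forward_bias \<omega> p)"
    by (simp add: backward_bias_def forward_bias_def)
  have "norm_moment M 2 ?K (vec_cond_exp M F ?U)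
      \<le> 2 * norm_moment M 2 ?K (vec_cond_exp M F backward_bias)
        + 2 * norm_moment M 2 ?K (vec_cond_exp M F forward_bias)"
    unfolding U
    by (intro norm_moment_2_add_le finite_weight_index AE_finite_allI)
      (auto simp: vec_cond_exp_def intro: F.real_cond_exp_add backward_bias_integrable forward_bias_integrable)
  also have "\<dots> \<le> ?SE + ?SD"
  proof (rule add_mono)
    show "2 * norm_moment M 2 ?K (vec_cond_exp M F forward_bias) \<le> ?SD"
    proof -
      have "2 * norm_moment M 2 ?K (vec_cond_exp M F forward_bias) \<le> 2 * norm_moment M 2 ?K forward_bias"
        by (intro mult_left_mono F.norm_moment_cond_exp_le finite_weight_index forward_bias_integrable) auto
      also have "\<dots> \<le> (\<Sum>i=1..N - 1. ennreal (Cb_delta N C1 C2 i) * norm_moment M 2 {..<d i} (\<lambda>\<omega>. D \<omega> i))"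
        by (rule forward_bias_moment)
      also have "\<dots> = ?SD"
        by (intro sum.cong refl) (auto simp: norm_moment_cond_exp_D)
      finally show ?thesis .
    qed
    show "2 * norm_moment M 2 ?K (vec_cond_exp M F backward_bias) \<le> ?SE"
    proof -
      have "2 * norm_moment M 2 ?K (vec_cond_exp M F backward_bias)
          \<le> 2 * norm_moment M 2 ?K (vec_cond_exp M (G N) backward_bias)"
        by (intro mult_left_mono F.norm_moment_cond_exp_mono M_G F_G finite_weight_index backward_bias_integrable) auto
      also have "\<dots> \<le> (\<Sum>i=1..N - 1. ennreal (Cb_eps C1 (i + 1)) *
            norm_moment M 2 {..<d i} (vec_cond_exp M (G N) (\<lambda>\<omega>. E \<omega> (i + 1))))"
        by (rule backward_bias_moment)
      also have "\<dots> \<le> ?SE"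
        by (intro sum_mono mult_left_mono G.norm_moment_cond_exp_mono M_H G_H) (auto intro: E_int)
      finally show ?thesis .
    qed
  qed
  finally show ?thesis
    by (simp add: add.commute)
qed

end

text \<open>Integrability of the perturbations gives meaning to their real conditional expectations,
  while second and fourth moments may be infinite. The hypothesis \<open>bound_hess11\<close> gives
  the second derivative in the layer input the same constant \<open>C2\<close> as
  \<open>hess21\<close>; it starts at layer 2, where the backward recursion ends.\<close>

theorem theorem2:
  fixes M :: "'a measure"
    and N T :: nat
    and d dw :: "nat \<Rightarrow> nat"
    and f :: "nat \<Rightarrow> layer_map"
    and R :: "(nat \<times> nat \<Rightarrow> real) \<Rightarrow> real"
    and \<gamma> C1 C2 Lf L1 L2 :: real
    and w :: "nat \<Rightarrow> 'a \<Rightarrow> nat \<times> nat \<Rightarrow> real"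
    and x :: "nat \<Rightarrow> 'a \<Rightarrow> rvec"
    and \<delta> \<epsilon> :: "nat \<Rightarrow> 'a \<Rightarrow> nat \<Rightarrow> rvec"
  assumes prob: "prob_space M"
    and N: "N \<ge> 2"
    and d_pos: "\<forall>i<N. d i > 0"
    and d_N: "d N = 1"
    and dw_pos: "\<forall>i\<in>{1..N}. dw i > 0"
    and f: "\<forall>i\<in>{1..N}. twice_diff_operator (d (i - 1)) (dw i) (d i) (f i)"
    and R: "\<forall>W\<in>vecs (weight_index N dw). frechet_diff_at (weight_index N dw) R W"
    and consts_pos: "C1 > 0" "C2 > 0" "Lf > 0" "L1 > 0" "L2 > 0"
    and regular: "\<forall>i\<in>{1..N}. regular_operator (d (i - 1)) (dw i) (d i) (f i) C1 C2 Lf L1 L2"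
    and bound_hess11: "\<forall>i\<in>{2..N}. \<forall>y\<in>vecs {..<d (i - 1)}. \<forall>v\<in>vecs {..<dw i}.
          op_norm {..<d i} ({..<d (i - 1)} \<times> {..<d (i - 1)}) (hess11 (f i) y v) \<le> C2"
    and step_size: "\<gamma> > 0"
    and x_vec: "\<forall>t\<in>{1..T}. \<forall>\<omega>\<in>space M. x t \<omega> \<in> vecs {..<d 0}"
    and x_meas: "\<forall>t\<in>{1..T}. \<forall>k<d 0. (\<lambda>\<omega>. x t \<omega> k) \<in> borel_measurable M"
    and \<delta>_vec: "\<forall>t\<in>{1..T}. \<forall>\<omega>\<in>space M. \<forall>i\<in>{1..N}. \<delta> t \<omega> i \<in> vecs {..<d i}"
    and \<delta>_int: "\<forall>t\<in>{1..T}. \<forall>i\<in>{1..N}. \<forall>k<d i. integrable M (\<lambda>\<omega>. \<delta> t \<omega> i k)"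
    and \<epsilon>_vec: "\<forall>t\<in>{1..T}. \<forall>\<omega>\<in>space M. \<forall>i\<in>{2..N}. \<epsilon> t \<omega> i \<in> vecs {..<d (i - 1)}"
    and \<epsilon>_int: "\<forall>t\<in>{1..T}. \<forall>i\<in>{2..N}. \<forall>k<d (i - 1). integrable M (\<lambda>\<omega>. \<epsilon> t \<omega> i k)"
    and w_vec: "\<forall>t\<in>{1..T}. \<forall>\<omega>\<in>space M. w t \<omega> \<in> vecs (weight_index N dw)"
    and w_init: "\<forall>p\<in>weight_index N dw. (\<lambda>\<omega>. w 1 \<omega> p) \<in> borel_measurable M"
    and w_step: "\<forall>t\<in>{1..<T}. \<forall>\<omega>\<in>space M. \<forall>p\<in>weight_index N dw.
          w (Suc t) \<omega> p = w t \<omega> p -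
            \<gamma> * (stacked_grad N d f (w t \<omega>) (x t \<omega>) (\<delta> t \<omega>) (\<epsilon> t \<omega>) p + partial R p (w t \<omega>))"
  shows "\<forall>t\<in>{1..T}.
    norm_moment M 2 (weight_index N dw)
      (vec_cond_exp M (F_alg M N d dw w x \<delta> \<epsilon> t)
        (\<lambda>\<omega> p. stacked_grad N d f (w t \<omega>) (x t \<omega>) (\<delta> t \<omega>) (\<epsilon> t \<omega>) p -
               stacked_grad N d f (w t \<omega>) (x t \<omega>) (\<lambda>_ _. 0) (\<lambda>_ _. 0) p))
    \<le> (\<Sum>i=1..N - 1. ennreal (Cb_delta N C1 C2 i) *
          norm_moment M 2 {..<d i}
            (vec_cond_exp M (G_alg M N d dw f w x \<delta> \<epsilon> t i) (\<lambda>\<omega>. \<delta> t \<omega> i)))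
      + (\<Sum>i=1..N - 1. ennreal (Cb_delta4 N C1 C2 Lf L1 L2 i) *
          norm_moment M 4 {..<d i} (\<lambda>\<omega>. \<delta> t \<omega> i))
      + (\<Sum>i=1..N - 1. ennreal (Cb_eps C1 (i + 1)) *
          norm_moment M 2 {..<d i}
            (vec_cond_exp M (H_alg M N d dw f w x \<delta> \<epsilon> t (i + 1)) (\<lambda>\<omega>. \<epsilon> t \<omega> (i + 1))))"
proof (rule ballI, goal_cases)
  case t: (1 t)
  interpret prob_space M by (rule prob)
  interpret regular_network N d dw f C1 C2
  proof
    show "1 \<le> N" "d N = 1" "0 \<le> C1" "0 \<le> C2"
      using N d_N consts_pos by auto
    fix i assume i: "i < N"
    then have Suc: "Suc i \<in> {1..N}" by simp
    show "twice_diff_operator (d i) (dw (Suc i)) (d (Suc i)) (f (Suc i))"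
      using bspec[OF f Suc] by simp
    have reg: "regular_operator (d i) (dw (Suc i)) (d (Suc i)) (f (Suc i)) C1 C2 Lf L1 L2"
      using bspec[OF regular Suc] by simp
    fix y v assume y: "y \<in> vecs {..<d i}" and v: "v \<in> vecs {..<dw (Suc i)}"
    show "op_norm {..<d (Suc i)} {..<d i} (jac1 (f (Suc i)) y v) \<le> C1"
      "op_norm {..<d (Suc i)} {..<dw (Suc i)} (jac2 (f (Suc i)) y v) \<le> C1"
      "op_norm {..<d (Suc i)} ({..<dw (Suc i)} \<times> {..<d i}) (hess21 (f (Suc i)) y v) \<le> C2"
      using reg y v unfolding regular_operator_def by blast+
    assume "0 < i"
    then have "Suc i \<in> {2..N}" using i by simp
    from bspec[OF bound_hess11 this] y v
    show "op_norm {..<d (Suc i)} ({..<d i} \<times> {..<d i}) (hess11 (f (Suc i)) y v) \<le> C2"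
      by simp
  qed
  have E_int: "integrable M (\<lambda>\<omega>. \<epsilon> s \<omega> (Suc i) k)" if "s \<in> {1..T}" "1 \<le> i" "i < N" "k < d i" for s i k
    using \<epsilon>_int that by force
  have D_meas: "(\<lambda>\<omega>. \<delta> s \<omega> i k) \<in> borel_measurable M" if "s \<in> {1..T}" "1 \<le> i" "i \<le> N" "k < d i" for s i k
    using \<delta>_int that by (intro borel_measurable_integrable) auto
  \<comment> \<open>Among the weights only the first are assumed measurable; later ones inherit it
    along the update rule, through both passes and the partial derivatives of
    \<open>R\<close>.\<close>
  have w_meas: "(\<lambda>\<omega>. w s \<omega> p) \<in> borel_measurable M" if "s \<in> {1..T}" "p \<in> weight_index N dw" for s p
    using that
  proof (induction s arbitrary: p)
    case 0
    then show ?case by simp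
  next
    case (Suc s)
    show ?case
    \<comment> \<open>Iterations count from 1, so the true base case is
      \<open>Suc 0\<close>.\<close>
    proof (cases "s = 0")
      case True
      then show ?thesis using w_init Suc by simp
    next
      case False
      with Suc have s: "s \<in> {1..T}" "s \<in> {1..<T}" by auto
      have "(\<lambda>\<omega>. stacked_grad N d f (w s \<omega>) (x s \<omega>) (\<delta> s \<omega>) (\<epsilon> s \<omega>) p) \<in> borel_measurable M"
        using s w_vec x_vec \<delta>_vec x_meas D_meas E_int[OF s(1)] Suc
        by (intro stacked_grad_measurable) auto
      moreover have "(\<lambda>\<omega>. partial R p (w s \<omega>)) \<in> borel_measurable M"
        using s w_vec R Suc finite_weight_index by (intro borel_measurable_partial) auto
      ultimately have "(\<lambda>\<omega>. w s \<omega> p - \<gamma> * (stacked_grad N d f (w s \<omega>) (x s \<omega>) (\<delta> s \<omega>) (\<epsilon> s \<omega>) p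
          + partial R p (w s \<omega>))) \<in> borel_measurable M"
        using Suc s by auto
      then show ?thesis
        using w_step s Suc.prems by (subst measurable_cong) auto
    qed
  qed
  have y_meas: "(\<lambda>\<omega>. forward f (w t \<omega>) (x t \<omega>) (\<delta> t \<omega>) j k) \<in> borel_measurable M" if "j \<le> N" "k < d j" for j k
    using t that w_vec x_vec \<delta>_vec x_meas D_meas w_meas
    by (intro forward_measurable) auto
  have v_meas: "(\<lambda>\<omega>. backward N d f (w t \<omega>) (forward f (w t \<omega>) (x t \<omega>) (\<delta> t \<omega>)) (\<epsilon> t \<omega>) l k)
      \<in> borel_measurable M" if "1 \<le> l" "l \<le> N" "k < d l" for l k
  proof (intro backward_measurable that)
    show "forward f (w t \<omega>) (x t \<omega>) (\<delta> t \<omega>) i \<in> vecs {..<d i}" if "\<omega> \<in> space M" "i < N" for \<omega> i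
      using t that w_vec x_vec \<delta>_vec by (intro forward_vecs) auto
  qed (use t w_vec w_meas y_meas E_int in auto)
  have F_sub: "F_generators N d dw w x \<delta> \<epsilon> t \<subseteq> borel_measurable M"
  proof -
    have "(\<lambda>\<omega>. \<epsilon> s \<omega> i k) \<in> borel_measurable M" if "s \<in> {1..<t}" "i \<in> {2..N}" "k < d (i - 1)" for s i k
      using \<epsilon>_int t that by (intro borel_measurable_integrable) auto
    moreover have "(\<lambda>\<omega>. \<delta> s \<omega> i k) \<in> borel_measurable M" if "s \<in> {1..<t}" "i \<in> {1..N}" "k < d i" for s i k
      using t that by (intro D_meas) auto
    moreover have "(\<lambda>\<omega>. w s \<omega> p) \<in> borel_measurable M" if "s \<in> {1..t}" "p \<in> weight_index N dw" for s p
      using t that by (intro w_meas) auto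
    moreover have "(\<lambda>\<omega>. x s \<omega> k) \<in> borel_measurable M" if "s \<in> {1..t}" "k < d 0" for s k
      using t that x_meas by auto
    ultimately show ?thesis
      unfolding F_generators_def by blast
  qed
  have G_sub: "G_generators N d dw f w x \<delta> \<epsilon> t i \<subseteq> borel_measurable M" if "i \<le> N" for i
    unfolding G_generators_def using F_sub y_meas that by auto
  \<comment> \<open>The generators of \<open>F_alg\<close> include the weights and the sample of
    iteration \<open>t\<close> itself, so these are fixed under every conditioning.\<close>
  have t_mem: "t \<in> {1..t}"
    using t by simp
  interpret step: perturbed_step N d dw f C1 C2 M "F_alg M N d dw w x \<delta> \<epsilon> t"
    "G_alg M N d dw f w x \<delta> \<epsilon> t" "H_alg M N d dw f w x \<delta> \<epsilon> t" "w t" "x t" "\<delta> t" "\<epsilon> t"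
  proof
    show "subalgebra (G_alg M N d dw f w x \<delta> \<epsilon> t i) (F_alg M N d dw w x \<delta> \<epsilon> t)" for i
      unfolding F_alg_def G_alg_def G_generators_def by (intro subalgebra_generated_algebra_mono) auto
    show "subalgebra (G_alg M N d dw f w x \<delta> \<epsilon> t N) (G_alg M N d dw f w x \<delta> \<epsilon> t i)" if "i \<le> N" for i
      unfolding G_alg_def G_generators_def using that by (intro subalgebra_generated_algebra_mono) fastforce
    show "subalgebra (H_alg M N d dw f w x \<delta> \<epsilon> t i) (G_alg M N d dw f w x \<delta> \<epsilon> t N)" for i
      unfolding H_alg_def G_alg_def by (intro subalgebra_generated_algebra_mono) auto
    show "subalgebra M (H_alg M N d dw f w x \<delta> \<epsilon> t i)" if "1 \<le> i" for i
      unfolding H_alg_def using G_sub[of N] v_meas that by (intro subalgebra_generated_algebra) auto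
    show "(\<lambda>\<omega>. w t \<omega> p) \<in> borel_measurable (F_alg M N d dw w x \<delta> \<epsilon> t)" if "p \<in> weight_index N dw" for p
      unfolding F_alg_def F_generators_def using that t_mem by (intro generated_algebra_measurable) blast
    show "(\<lambda>\<omega>. x t \<omega> k) \<in> borel_measurable (F_alg M N d dw w x \<delta> \<epsilon> t)" if "k < d 0" for k
      unfolding F_alg_def F_generators_def using that t_mem by (intro generated_algebra_measurable) blast
    show "(\<lambda>\<omega>. forward f (w t \<omega>) (x t \<omega>) (\<delta> t \<omega>) j k) \<in> borel_measurable (G_alg M N d dw f w x \<delta> \<epsilon> t i)"
      if "1 \<le> j" "j \<le> i" "k < d j" for i j k
      unfolding G_alg_def G_generators_def using that by (intro generated_algebra_measurable) auto
  qed (use t w_vec x_vec \<delta>_vec \<delta>_int E_int in auto)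
  show ?case
    by (rule order_trans[OF step.bias_moment]) (intro add_mono, auto)
qed

end
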